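(* Let $\mathfrak u$ be a non-principal ultrafilter on $\mathscr P(\omega)$. Then the following conditions are equivalent: (1) $\mathfrak u$ is a Ramsey ultrafilter; (2) for every $n$, $1\leq n<\omega$, and every partition $\mathcal P$ of $[\omega]^n$, $\mathfrak u$ contains some set $X$ that is canonical for $\mathcal P$; (3) for every $n$, $1\leq n<\omega$, and every function $f:\omega^n\to\omega$, $\mathfrak u$ contains some set $X$ such that $f$ is either selectively upward injective or upward constant on $X$; (4) for every $n$, $1\leq n<\omega$, and every function $f:\omega^n\to\omega$, either $\widetilde f(\mathfrak u,\mathfrak u,\ldots,\mathfrak u)$ is principal or $\widetilde f(\mathfrak u,\mathfrak u,\ldots,\mathfrak u)\approx_{\mathrm{RK}}\underbrace{\mathfrak u\times\mathfrak u\times\ldots\times\mathfrak u}_{m\text{ times}}$ for some $m$, $1\leq m\leq n$.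
   Context: Natural numbers are identified with finite ordinals, so $n=\{0,1,\dots,n-1\}$, and $\omega$ is the set of all natural numbers. For a set $X$ and $n\in\omega$, $[X]^n=\{\bm x\subseteq X: |\bm x|=n\}$. For $X\subseteq\omega$ and $i<|X|$, $X_{[i]}$ denotes the $i$-th element of $X$ in the natural ordering (counting from $0$). Partitions. A set $\mathcal P\subseteq\mathscr P(Z)$ is a partition of $Z$ if $\bigcup\mathcal P=Z$ and any two distinct elements of $\mathcal P$ are disjoint (one element may be empty; $\mathcal P$ may be infinite). For $x,y\in Z$, $x\approx_{\mathcal P}y$ means that $x,y\in P$ for some $P\in\mathcal P$. For a partition $\mathcal P$ of $[\omega]^n$, a set $Y\subseteq\omega$ is homogeneous for $\mathcal P$ if $[Y]^n\subseteq P$ for some $P\in\mathcal P$. For $I\subseteq n$, a set $X\subseteq\omega$ is $I$-canonical for $\mathcal P$ if for all $\bm p,\bm q\in[X]^n$: $\bm p\approx_{\mathcal P}\bm q$ iff $\bm p_{[i]}=\bm q_{[i]}$ for all $i\in I$; $X$ is canonical for $\mathcal P$ if it is $I$-canonical for $\mathcal P$ for some $I\subseteq n$. Ramsey ultrafilters. An ultrafilter $\mathfrak u$ on $\mathscr P(\omega)$ is a Ramsey ultrafilter if it is nonprincipal and for any $n$, $1\le n<\omega$, and any finite partition $\mathcal P$ of $[\omega]^n$, $\mathfrak u$ contains some set $X\subseteq\omega$ that is homogeneous for $\mathcal P$. Upward injective and constant functions. A function $f:\omega^n\to\omega$ is selectively upward injective on $X\subseteq\omega$ with respect to $I\subseteq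 n$ if for all $x_0<x_1<\dots<x_{n-1}$ and $y_0<y_1<\dots<y_{n-1}$ from $X$: $f(x_0,\ldots,x_{n-1})=f(y_0,\ldots,y_{n-1})$ iff $x_i=y_i$ for all $i\in I$. It is selectively upward injective on $X$ if it is selectively upward injective on $X$ w.r.t. some non-empty $J\subseteq n$. It is upward constant on $X$ if it is selectively upward injective on $X$ w.r.t. $\emptyset$, i.e. $f(x_0,\ldots,x_{n-1})=f(y_0,\ldots,y_{n-1})$ for all $x_0<\dots<x_{n-1}$ and $y_0<\dots<y_{n-1}$ from $X$. Ultrafilter extensions. $\bm\beta A$ is the set of all ultrafilters on $\mathscr P(A)$. For $f:A^n\to B$ the extension $\widetilde f:(\bm\beta A)^n\to\bm\beta B$ is defined by recursion on $n$: a nullary $f$ is identified with a constant $c_f\in B$ and $\widetilde f=\{S\subseteq B:c_f\in S\}$; for $n>0$, $$\widetilde f(\mathfrak u_1,\ldots,\mathfrak u_n)=\{S\subseteq B:(\forall X\in\mathfrak u_1)(\exists x\in X)\ S\in\widetilde{f_x}(\mathfrak u_2,\ldots,\mathfrak u_n)\},$$ where $f_x(x_2,\ldots,x_n)=f(x,x_2,\ldots,x_n)$. Rudin-Keisler relations. For $\mathfrak u,\mathfrak v\in\bm\beta A$, $\mathfrak u\leq_{\mathrm{RK}}\mathfrak v$ iff $\widetilde f(\mathfrak v)=\mathfrak u$ for some $f:A\to A$; $\mathfrak u\approx_{\mathrm{RK}}\mathfrak v$ iff $\mathfrak u\leq_{\mathrm{RK}}\mathfrak v$ and $\mathfrak v\leq_{\mathrm{RK}}\mathfrak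 u$. Products. Considering ultrafilters up to $\approx_{\mathrm{RK}}$, $\mathfrak u_0\times\mathfrak u_1\times\ldots\times\mathfrak u_{m-1}$ denotes the ultrafilter $\widetilde g(\mathfrak u_0,\mathfrak u_1,\ldots,\mathfrak u_{m-1})$ for some one-to-one map $g:\omega^m\to\omega$ (up to $\approx_{\mathrm{RK}}$ it does not depend on the choice of $g$). *)

theory Defs
  imports "HOL-Library.Ramsey" "HOL-Library.Infinite_Set" "HOL-Library.Disjoint_Sets"
begin

section \<open>Ultrafilters as families of sets\<close>

text \<open>
  Ultrafilters are families of subsets of a type. That a family is a filter is the library predicate
  \<^const>\<open>is_filter\<close>, which speaks about predicates instead of sets.
\<close>

definition ultrafilter :: "'a set set \<Rightarrow> bool" where
  "ultrafilter U \<longleftrightarrow>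
     is_filter (\<lambda>P. {x. P x} \<in> U) \<and> {} \<notin> U \<and> (\<forall>X. X \<in> U \<or> - X \<in> U)"

definition principal_uf :: "'a \<Rightarrow> 'a set set" where
  "principal_uf a = {S. a \<in> S}"

definition is_principal :: "'a set set \<Rightarrow> bool" where
  "is_principal U \<longleftrightarrow> (\<exists>a. U = principal_uf a)"

section \<open>Partitions, homogeneous and canonical sets\<close>

text \<open>In contrast to \<^const>\<open>partition_on\<close>, the empty set may be a member of a partition.\<close>

definition weak_partition :: "'a set \<Rightarrow> 'a set set \<Rightarrow> bool" where
  "weak_partition Z \<P> \<longleftrightarrow> \<Union>\<P> = Z \<and> disjoint \<P>"

definition part_equiv :: "'a set set \<Rightarrow> 'a \<Rightarrow> 'a \<Rightarrow> bool" where
  "part_equiv \<P> x y \<longleftrightarrow> (\<exists>P\<in>\<P>. x \<in> P \<and> y \<in> P)"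

definition homogeneous :: "nat \<Rightarrow> nat set set set \<Rightarrow> nat set \<Rightarrow> bool" where
  "homogeneous n \<P> Y \<longleftrightarrow> (\<exists>P\<in>\<P>. [Y]\<^bsup>n\<^esup> \<subseteq> P)"

text \<open>For \<open>i < card p\<close>, \<^term>\<open>enumerate p i\<close> is the \<open>i\<close>-th element of the finite set \<open>p\<close>,
  counting from \<open>0\<close>.\<close>

definition canonical_wrt :: "nat \<Rightarrow> nat set \<Rightarrow> nat set set set \<Rightarrow> nat set \<Rightarrow> bool" where
  "canonical_wrt n I \<P> X \<longleftrightarrow>
     (\<forall>p\<in>[X]\<^bsup>n\<^esup>. \<forall>q\<in>[X]\<^bsup>n\<^esup>.
        part_equiv \<P> p q \<longleftrightarrow> (\<forall>i\<in>I. enumerate p i = enumerate q i))"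

definition canonical :: "nat \<Rightarrow> nat set set set \<Rightarrow> nat set \<Rightarrow> bool" where
  "canonical n \<P> X \<longleftrightarrow> (\<exists>I\<subseteq>{..<n}. canonical_wrt n I \<P> X)"

definition ramsey_ultrafilter :: "nat set set \<Rightarrow> bool" where
  "ramsey_ultrafilter U \<longleftrightarrow>
     ultrafilter U \<and> \<not> is_principal U \<and>
     (\<forall>n\<ge>1. \<forall>\<P>. weak_partition ([UNIV :: nat set]\<^bsup>n\<^esup>) \<P> \<and> finite \<P> \<longrightarrow>
        (\<exists>X\<in>U. homogeneous n \<P> X))"

section \<open>Upward injective and upward constant functions\<close>

text \<open>
  An \<open>n\<close>-ary function is a function on lists of which only the values at lists of length \<open>n\<close>
  matter.
\<close>

definition increasing_tuples :: "nat \<Rightarrow> nat set \<Rightarrow> nat list set" where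
  "increasing_tuples n X = {xs. length xs = n \<and> sorted_wrt (<) xs \<and> set xs \<subseteq> X}"

definition sel_upward_inj_wrt :: "nat \<Rightarrow> (nat list \<Rightarrow> nat) \<Rightarrow> nat set \<Rightarrow> nat set \<Rightarrow> bool" where
  "sel_upward_inj_wrt n f X I \<longleftrightarrow>
     (\<forall>xs\<in>increasing_tuples n X. \<forall>ys\<in>increasing_tuples n X.
        f xs = f ys \<longleftrightarrow> (\<forall>i\<in>I. xs ! i = ys ! i))"

definition sel_upward_inj :: "nat \<Rightarrow> (nat list \<Rightarrow> nat) \<Rightarrow> nat set \<Rightarrow> bool" where
  "sel_upward_inj n f X \<longleftrightarrow> (\<exists>J\<subseteq>{..<n}. J \<noteq> {} \<and> sel_upward_inj_wrt n f X J)"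

definition upward_const :: "nat \<Rightarrow> (nat list \<Rightarrow> nat) \<Rightarrow> nat set \<Rightarrow> bool" where
  "upward_const n f X \<longleftrightarrow> sel_upward_inj_wrt n f X {}"

section \<open>Ultrafilter extensions, the Rudin-Keisler order, products\<close>

text \<open>The arity is the length of the list of ultrafilters.\<close>

primrec uf_ext :: "('a list \<Rightarrow> 'b) \<Rightarrow> 'a set set list \<Rightarrow> 'b set set" where
  "uf_ext f [] = principal_uf (f [])"
| "uf_ext f (u # us) = {S. \<forall>X\<in>u. \<exists>x\<in>X. S \<in> uf_ext (\<lambda>xs. f (x # xs)) us}"

definition rk_le :: "'a set set \<Rightarrow> 'a set set \<Rightarrow> bool" (infix \<open>\<le>\<^sub>R\<^sub>K\<close> 50) where
  "u \<le>\<^sub>R\<^sub>K v \<longleftrightarrow> (\<exists>f :: 'a \<Rightarrow> 'a. uf_ext (\<lambda>xs. f (hd xs)) [v] = u)"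

definition rk_equiv :: "'a set set \<Rightarrow> 'a set set \<Rightarrow> bool" (infix \<open>\<approx>\<^sub>R\<^sub>K\<close> 50) where
  "u \<approx>\<^sub>R\<^sub>K v \<longleftrightarrow> u \<le>\<^sub>R\<^sub>K v \<and> v \<le>\<^sub>R\<^sub>K u"

text \<open>
  A product of ultrafilters is determined only up to \<^const>\<open>rk_equiv\<close>; see
  \<open>uf_prod_independent\<close> below for the independence of the chosen injection.
\<close>

definition uf_prod :: "nat set set list \<Rightarrow> nat set set" where
  "uf_prod us = uf_ext (SOME g :: nat list \<Rightarrow> nat. inj_on g {xs. length xs = length us}) us"

lemma ultrafilterD:
  assumes "ultrafilter U"
  shows "is_filter (\<lambda>P. {x. P x} \<in> U)" and "{} \<notin> U" and "X \<notin> U \<Longrightarrow> - X \<in> U"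
proof -
  have U: "is_filter (\<lambda>P. {x. P x} \<in> U) \<and> {} \<notin> U \<and> (\<forall>X. X \<in> U \<or> - X \<in> U)"
    using assms by (unfold ultrafilter_def)
  show "is_filter (\<lambda>P. {x. P x} \<in> U)" by (rule conjunct1[OF U])
  show "{} \<notin> U" by (rule conjunct1[OF conjunct2[OF U]])
  have "X \<in> U \<or> - X \<in> U" by (rule spec[OF conjunct2[OF conjunct2[OF U]]])
  then show "X \<notin> U \<Longrightarrow> - X \<in> U" by (rule disjE) (erule notE, assumption)
qed

lemma ultrafilter_frequently_iff:
  assumes "ultrafilter U"
  shows "(\<forall>X\<in>U. \<exists>x\<in>X. Q x) \<longleftrightarrow> {x. Q x} \<in> U"
proof
  assume *: "\<forall>X\<in>U. \<exists>x\<in>X. Q x"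
  have "- {x. Q x} \<notin> U" using bspec[OF *, of "- {x. Q x}"] by auto
  then show "{x. Q x} \<in> U" using ultrafilterD(3)[OF assms, of "{x. Q x}"] by argo
next
  assume Q: "{x. Q x} \<in> U"
  show "\<forall>X\<in>U. \<exists>x\<in>X. Q x"
  proof
    fix X assume "X \<in> U"
    then have "{x. Q x \<and> x \<in> X} \<in> U"
      using Q is_filter.conj[OF ultrafilterD(1)[OF assms], of Q "\<lambda>x. x \<in> X"] by simp
    then have "{x. Q x \<and> x \<in> X} \<noteq> {}" using ultrafilterD(2)[OF assms] by (intro notI) simp
    then show "\<exists>x\<in>X. Q x" by blast
  qed
qed

lemma uf_ext_Cons_iff:
  "ultrafilter u \<Longrightarrow> S \<in> uf_ext f (u # us) \<longleftrightarrow> {x. S \<in> uf_ext (\<lambda>xs. f (x # xs)) us} \<in> u"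
  by (simp add: ultrafilter_frequently_iff)

lemma ultrafilter_principal_uf: "ultrafilter (principal_uf a)"
  by (auto simp: ultrafilter_def principal_uf_def is_filter_def)

lemma ultrafilter_uf_ext:
  "(\<forall>u\<in>set us. ultrafilter u) \<Longrightarrow> ultrafilter (uf_ext f us)"
proof (induction us arbitrary: f)
  case Nil
  show ?case by (simp add: ultrafilter_principal_uf)
next
  case (Cons u us)
  let ?E = "\<lambda>x. uf_ext (\<lambda>xs. f (x # xs)) us"
  have u: "ultrafilter u" and E: "ultrafilter (?E x)" for x
    using Cons by auto
  have filt: "is_filter (\<lambda>P. {x. P x} \<in> u)" and Efilt: "is_filter (\<lambda>P. {y. P y} \<in> ?E x)" for x
    by (rule ultrafilterD(1)[OF u], rule ultrafilterD(1)[OF E])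
  note iff = uf_ext_Cons_iff[OF u, of _ f us]
  show ?case
    unfolding ultrafilter_def
  proof (intro conjI allI)
    show "is_filter (\<lambda>P. {y. P y} \<in> uf_ext f (u # us))"
      unfolding iff
    proof
      show "{x. {y. True} \<in> ?E x} \<in> u"
        using is_filter.True[OF Efilt] is_filter.True[OF filt] by simp
    next
      fix P Q assume "{x. {y. P y} \<in> ?E x} \<in> u" "{x. {y. Q y} \<in> ?E x} \<in> u"
      then have "{x. {y. P y} \<in> ?E x \<and> {y. Q y} \<in> ?E x} \<in> u"
        by (rule is_filter.conj[OF filt])
      then show "{x. {y. P y \<and> Q y} \<in> ?E x} \<in> u"
        using is_filter.mono[OF filt, of "\<lambda>x. {y. P y} \<in> ?E x \<and> {y. Q y} \<in> ?E x"
            "\<lambda>x. {y. P y \<and> Q y} \<in> ?E x"] is_filter.conj[OF Efilt, of P _ Q]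
        by simp
    next
      fix P Q assume le: "\<forall>y. P y \<longrightarrow> Q y" and "{x. {y. P y} \<in> ?E x} \<in> u"
      then show "{x. {y. Q y} \<in> ?E x} \<in> u"
        using is_filter.mono[OF filt, of "\<lambda>x. {y. P y} \<in> ?E x" "\<lambda>x. {y. Q y} \<in> ?E x"]
          is_filter.mono[OF Efilt, of P Q]
        by simp
    qed
    show "{} \<notin> uf_ext f (u # us)"
      unfolding iff using ultrafilterD(2)[OF E] ultrafilterD(2)[OF u] by simp
    show "X \<in> uf_ext f (u # us) \<or> - X \<in> uf_ext f (u # us)" for X
    proof -
      have "{x. X \<in> ?E x} \<in> u \<or> - {x. X \<in> ?E x} \<in> u"
        using ultrafilterD(3)[OF u, of "{x. X \<in> ?E x}"] by argo
      moreover have "{x. - X \<in> ?E x} \<in> u" if "- {x. X \<in> ?E x} \<in> u"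
      proof -
        have "- {x. X \<in> ?E x} = {x. X \<notin> ?E x}" by blast
        moreover have "\<forall>x. X \<notin> ?E x \<longrightarrow> - X \<in> ?E x"
          using ultrafilterD(3)[OF E] by simp
        ultimately show ?thesis
          using is_filter.mono[OF filt, of "\<lambda>x. X \<notin> ?E x" "\<lambda>x. - X \<in> ?E x"] that by simp
      qed
      ultimately show ?thesis unfolding iff by blast
    qed
  qed
qed

lemma uf_ext_cong:
  "(\<And>xs. length xs = length us \<Longrightarrow> f xs = g xs) \<Longrightarrow> uf_ext f us = uf_ext g us"
proof (induction us arbitrary: f g)
  case (Cons u us)
  have "uf_ext (\<lambda>xs. f (x # xs)) us = uf_ext (\<lambda>xs. g (x # xs)) us" for x
    by (rule Cons.IH) (simp add: Cons.prems)
  then show ?case by simp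
qed simp

lemma uf_ext_unary_iff:
  "ultrafilter v \<Longrightarrow> S \<in> uf_ext (\<lambda>xs. h (hd xs)) [v] \<longleftrightarrow> h -` S \<in> v"
  by (subst uf_ext_Cons_iff) (auto simp: principal_uf_def vimage_def)

lemma uf_ext_vimage:
  "(\<forall>u\<in>set us. ultrafilter u) \<Longrightarrow> h -` S \<in> uf_ext g us \<longleftrightarrow> S \<in> uf_ext (\<lambda>xs. h (g xs)) us"
proof (induction us arbitrary: g)
  case Nil
  then show ?case by (simp add: principal_uf_def)
next
  case (Cons u us)
  then show ?case by (simp del: uf_ext.simps(2) add: uf_ext_Cons_iff)
qed

lemma uf_ext_rk_le:
  fixes g g' :: "nat list \<Rightarrow> nat"
  assumes "\<forall>u\<in>set us. ultrafilter u" and inj: "inj_on g {xs. length xs = length us}"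
  shows "uf_ext g' us \<le>\<^sub>R\<^sub>K uf_ext g us"
proof -
  define h where "h = g' \<circ> inv_into {xs. length xs = length us} g"
  have "uf_ext (\<lambda>xs. h (g xs)) us = uf_ext g' us"
    by (rule uf_ext_cong) (simp add: h_def inj)
  then have "uf_ext (\<lambda>xs. h (hd xs)) [uf_ext g us] = uf_ext g' us"
    by (intro set_eqI)
      (simp only: uf_ext_unary_iff[OF ultrafilter_uf_ext[OF assms(1)]] uf_ext_vimage[OF assms(1)])
  then show ?thesis unfolding rk_le_def by blast
qed

lemma uf_prod_independent:
  fixes g :: "nat list \<Rightarrow> nat"
  assumes "\<forall>u\<in>set us. ultrafilter u" and "inj_on g {xs. length xs = length us}"
  shows "uf_ext g us \<approx>\<^sub>R\<^sub>K uf_prod us"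
proof -
  have "inj_on (SOME g :: nat list \<Rightarrow> nat. inj_on g {xs. length xs = length us})
          {xs. length xs = length us}"
    by (rule someI[of "\<lambda>g. inj_on g {xs. length xs = length us}", OF assms(2)])
  then show ?thesis
    using assms unfolding rk_equiv_def uf_prod_def by (blast intro: uf_ext_rk_le)
qed

end

theory Submission
  imports Defs "HOL-Library.Nat_Bijection"
begin

text \<open>
  Let \<open>u\<^sup>n\<close> be the \<open>n\<close>-fold power of \<open>u\<close>, the ultrafilter on lists that contains \<open>A\<close> when for
  \<open>u\<close>-almost all \<open>x\<^sub>0\<close>, for \<open>u\<close>-almost all \<open>x\<^sub>1\<close>, and so on, the list of the \<open>x\<^sub>i\<close> lies in \<open>A\<close>
  (\<open>uf_power\<close>). The extension of \<open>f\<close> at \<open>(u, \<dots>, u)\<close> is the image of \<open>u\<^sup>n\<close> under \<open>f\<close>. As \<open>u\<close> is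
  nonprincipal, \<open>u\<^sup>n\<close> contains the set of increasing \<open>n\<close>-tuples from any \<open>X \<in> u\<close>. Being Ramsey
  says exactly that these sets generate \<open>u\<^sup>n\<close> for every \<open>n\<close> (\<open>upward_generated\<close>): an ultrafilter
  decides every finite partition, and a homogeneous set can only land in the piece that \<open>u\<^sup>n\<close> chose.

  From generation to canonical functions, the proof is that of the Erdos-Rado theorem. For some
  \<open>X \<in> u\<close>, whether \<open>f p = f q\<close> depends only on the order pattern of the pair \<open>(p, q)\<close>, because there
  are finitely many patterns and each is decided by a power of \<open>u\<close>. Then the value of \<open>f\<close> is
  determined, injectively, by the coordinates that cannot be changed alone without changing it
  (\<open>eq_if_agree\<close>, \<open>eq_imp_agree\<close>). Canonical partitions and selectively injective functions are
  the same thing, since a partition of the countable set of \<open>n\<close>-sets is the kernel of a function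
  to the natural numbers (\<open>canonical_iff_sel_upward_inj\<close>).

  If \<open>f\<close> is selectively injective with respect to \<open>J\<close> on a set in \<open>u\<close>, then \<open>f\<close> has there the same
  kernel as an injection composed with the projection to the coordinates in \<open>J\<close>. Maps that have
  the same kernel almost everywhere have equivalent images, and the projection sends \<open>u\<^sup>n\<close> to \<open>u\<^sup>m\<close>
  for \<open>m = card J\<close>. This describes the images of the powers of \<open>u\<close>.

  The circle closes through unary functions. If \<open>f(u)\<close> is equivalent to \<open>u\<close>, then some \<open>h \<circ> f\<close> maps
  \<open>u\<close> to itself, and a self-map that preserves an ultrafilter is the identity almost everywhere
  (\<open>preserving_map_eq_id\<close>), so \<open>f\<close> is injective on a set in \<open>u\<close>. Hence \<open>u\<close> is selective. A
  selective ultrafilter has diagonal intersections (\<open>selective_diagonal\<close>), and these yield, by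
  induction on \<open>n\<close>, that \<open>u\<^sup>n\<close> is generated by increasing tuples.
\<close>

section \<open>Ultrafilters\<close>

lemma ultrafilter_UNIV: "ultrafilter u \<Longrightarrow> UNIV \<in> u"
  using is_filter.True[OF ultrafilterD(1)] by simp

lemma ultrafilter_mono:
  assumes "ultrafilter u" "X \<in> u" "X \<subseteq> Y"
  shows "Y \<in> u"
  using is_filter.mono[OF ultrafilterD(1)[OF assms(1)], of "\<lambda>x. x \<in> X" "\<lambda>x. x \<in> Y"] assms by auto

lemma ultrafilter_Int:
  assumes "ultrafilter u" "X \<in> u" "Y \<in> u"
  shows "X \<inter> Y \<in> u"
  using is_filter.conj[OF ultrafilterD(1)[OF assms(1)], of "\<lambda>x. x \<in> X" "\<lambda>x. x \<in> Y"] assms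
  by (simp add: Int_def)

lemma ultrafilter_Compl_iff:
  assumes "ultrafilter u"
  shows "- X \<in> u \<longleftrightarrow> X \<notin> u"
  using ultrafilterD(2,3)[OF assms] ultrafilter_Int[OF assms, of X "- X"] by auto

lemma ultrafilter_disjoint:
  assumes "ultrafilter u" "X \<in> u" "Y \<in> u"
  shows "X \<inter> Y \<noteq> {}"
  using ultrafilter_Int[OF assms] ultrafilterD(2)[OF assms(1)] by auto

lemma ultrafilter_INT:
  assumes "ultrafilter u" "finite I" "\<And>i. i \<in> I \<Longrightarrow> X i \<in> u"
  shows "(\<Inter>i\<in>I. X i) \<in> u"
  using assms(2,3)
  by (induction I) (auto intro: ultrafilter_UNIV[OF assms(1)] ultrafilter_Int[OF assms(1)])

lemma ultrafilter_UN:
  assumes u: "ultrafilter u" and "finite I" "(\<Union>i\<in>I. X i) \<in> u"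
  shows "\<exists>i\<in>I. X i \<in> u"
proof (rule ccontr)
  assume "\<not> ?thesis"
  then have "(\<Inter>i\<in>I. - X i) \<in> u"
    using assms by (intro ultrafilter_INT) (auto simp: ultrafilter_Compl_iff)
  moreover have "(\<Inter>i\<in>I. - X i) = - (\<Union>i\<in>I. X i)" by auto
  ultimately show False using assms ultrafilter_Compl_iff[OF u] by metis
qed

text \<open>
  A finite set in the ultrafilter splits into singletons, one of which is in the ultrafilter and
  makes it principal.
\<close>

lemma nonprincipal_infinite:
  assumes u: "ultrafilter u" and np: "\<not> is_principal u" and X: "X \<in> u"
  shows "infinite X"
proof
  assume "finite X"
  then obtain a where a: "{a} \<in> u"
    using ultrafilter_UN[OF u, of X "\<lambda>x. {x}"] X by auto
  have "S \<in> u \<longleftrightarrow> a \<in> S" for S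
    using ultrafilter_mono[OF u a, of S] ultrafilter_disjoint[OF u a, of S] by auto
  then have "u = principal_uf a" by (auto simp: principal_uf_def)
  then show False using np by (auto simp: is_principal_def)
qed

text \<open>
  The Fubini power, as an ultrafilter on all lists; it contains the set of lists of length \<open>n\<close>.
  With values in lists no coding of tuples by elements of the type is needed.
\<close>

definition uf_power :: "'a set set \<Rightarrow> nat \<Rightarrow> 'a list set set" where
  "uf_power u n = uf_ext (\<lambda>xs. xs) (replicate n u)"

lemma ultrafilter_uf_power: "ultrafilter u \<Longrightarrow> ultrafilter (uf_power u n)"
  unfolding uf_power_def by (rule ultrafilter_uf_ext) auto

lemma uf_power_0: "A \<in> uf_power u 0 \<longleftrightarrow> [] \<in> A"
  by (simp add: uf_power_def principal_uf_def)

lemma uf_power_Suc: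
  assumes "ultrafilter u"
  shows "A \<in> uf_power u (Suc n) \<longleftrightarrow> {x. {xs. x # xs \<in> A} \<in> uf_power u n} \<in> u"
proof -
  have "A \<in> uf_ext (\<lambda>xs. x # xs) (replicate n u) \<longleftrightarrow> {xs. x # xs \<in> A} \<in> uf_power u n" for x
    using uf_ext_vimage[of "replicate n u" "(#) x" A "\<lambda>xs. xs"] assms
    by (simp add: uf_power_def vimage_def)
  then show ?thesis
    by (simp add: uf_power_def uf_ext_Cons_iff[OF assms] del: uf_ext.simps)
qed

lemma uf_ext_replicate_iff:
  "ultrafilter u \<Longrightarrow> S \<in> uf_ext f (replicate n u) \<longleftrightarrow> f -` S \<in> uf_power u n"
  using uf_ext_vimage[of "replicate n u" f S "\<lambda>xs. xs"] by (simp add: uf_power_def)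

section \<open>Increasing tuples\<close>

lemma increasing_tuples_0: "increasing_tuples 0 X = {[]}"
  by (auto simp: increasing_tuples_def)

lemma Cons_increasing_tuples:
  "x # xs \<in> increasing_tuples (Suc n) X \<longleftrightarrow> x \<in> X \<and> xs \<in> increasing_tuples n (X \<inter> {x<..})"
  by (auto simp: increasing_tuples_def)

lemma increasing_tuples_mono: "X \<subseteq> Y \<Longrightarrow> increasing_tuples n X \<subseteq> increasing_tuples n Y"
  by (auto simp: increasing_tuples_def)

lemma map_increasing_tuples:
  assumes "xs \<in> increasing_tuples n X" "strict_mono_on (set xs) \<phi>" "\<phi> ` set xs \<subseteq> Y"
  shows "map \<phi> xs \<in> increasing_tuples n Y"
proof -
  have "sorted_wrt (\<lambda>x y. \<phi> x < \<phi> y) xs"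
  proof (rule sorted_wrt_mono_rel)
    show "sorted_wrt (<) xs" using assms(1) by (simp add: increasing_tuples_def)
    show "\<phi> x < \<phi> y" if "x \<in> set xs" "y \<in> set xs" "x < y" for x y
      using strict_mono_onD[OF assms(2) that] .
  qed
  then show ?thesis
    using assms(1,3) unfolding increasing_tuples_def by (simp add: sorted_wrt_map)
qed

lemma increasing_tuples_infinite:
  assumes "infinite X"
  shows "increasing_tuples n X \<noteq> {}"
proof -
  have "map (enumerate X) [0..<n] \<in> increasing_tuples n X"
    using assms by (intro map_increasing_tuples[of _ _ UNIV])
      (auto simp: increasing_tuples_def strict_mono_on_def enumerate_in_set)
  then show ?thesis by blast
qed

text \<open>
  Once the first entry \<open>x\<close> has been chosen, the remaining entries range over the elements of \<open>X\<close> above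
  \<open>x\<close>. These still form a set in the ultrafilter, because only finitely many elements are removed.
\<close>

lemma increasing_tuples_in_uf_power:
  assumes u: "ultrafilter u" and np: "\<not> is_principal u" and X: "X \<in> u"
  shows "increasing_tuples n X \<in> uf_power u n"
  using X
proof (induction n arbitrary: X)
  case 0
  then show ?case by (simp add: uf_power_0 increasing_tuples_0)
next
  case (Suc n)
  have "{x<..} \<in> u" for x :: nat
    using nonprincipal_infinite[OF u np, of "{..x}"] ultrafilter_Compl_iff[OF u, of "{..x}"]
    by (auto simp: Compl_atMost)
  then have *: "increasing_tuples n (X \<inter> {x<..}) \<in> uf_power u n" for x
    using Suc ultrafilter_Int[OF u] by simp
  have "{xs. x # xs \<in> increasing_tuples (Suc n) X} \<in> uf_power u n" if "x \<in> X" for x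
    using * that by (simp add: Cons_increasing_tuples)
  then show ?case
    unfolding uf_power_Suc[OF u]
    by (intro ultrafilter_mono[OF u Suc.prems] subsetI CollectI)
qed

section \<open>Ramsey ultrafilters and ultrafilter powers\<close>

definition upward_generated :: "nat set set \<Rightarrow> bool" where
  "upward_generated u \<longleftrightarrow> (\<forall>n. \<forall>A\<in>uf_power u n. \<exists>X\<in>u. increasing_tuples n X \<subseteq> A)"

lemma increasing_tuples_imp_nsets:
  "xs \<in> increasing_tuples n X \<Longrightarrow> set xs \<in> [X]\<^bsup>n\<^esup>"
  by (auto simp: increasing_tuples_def nsets_def strict_sorted_iff distinct_card)

lemma nsetsE_increasing_tuple:
  assumes "p \<in> [X]\<^bsup>n\<^esup>"
  obtains xs where "xs \<in> increasing_tuples n X" "p = set xs"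
  using that[of "sorted_list_of_set p"] assms
  by (auto simp: increasing_tuples_def nsets_def)

text \<open>
  Split the \<open>n\<close>-sets according to whether their increasing enumeration is in \<open>A\<close>. The increasing
  tuples from a homogeneous \<open>X\<close> meet \<open>A\<close>, as both sets are in the power, so all of them are in \<open>A\<close>.
\<close>

lemma ramsey_ultrafilter_imp_upward_generated:
  assumes "ramsey_ultrafilter u"
  shows "upward_generated u"
  unfolding upward_generated_def
proof (intro allI ballI)
  fix n A assume A: "A \<in> uf_power u n"
  have u: "ultrafilter u" and np: "\<not> is_principal u"
    using assms by (auto simp: ramsey_ultrafilter_def)
  show "\<exists>X\<in>u. increasing_tuples n X \<subseteq> A"
  proof (cases "n = 0")
    case True
    then show ?thesis using A ultrafilter_UNIV[OF u]
      by (auto simp: uf_power_0 increasing_tuples_0)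
  next
    case False
    \<comment> \<open>Finite sets correspond to their increasing enumerations, which makes \<open>C\<close> a faithful copy of \<open>A\<close>.\<close>
    define C where "C = set ` (increasing_tuples n UNIV \<inter> A)"
    let ?N = "[UNIV :: nat set]\<^bsup>n\<^esup>"
    have "weak_partition ?N {C, ?N - C}"
      using increasing_tuples_imp_nsets by (auto simp: weak_partition_def disjoint_def C_def)
    then obtain X where X: "X \<in> u" and "homogeneous n {C, ?N - C} X"
      using assms False by (auto simp: ramsey_ultrafilter_def dest!: spec[of _ n])
    then have cases: "[X]\<^bsup>n\<^esup> \<subseteq> C \<or> [X]\<^bsup>n\<^esup> \<subseteq> ?N - C" by (auto simp: homogeneous_def)
    have inC: "xs \<in> A" if "xs \<in> increasing_tuples n X" "set xs \<in> C" for xs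
    proof -
      obtain ys where "ys \<in> increasing_tuples n UNIV" "ys \<in> A" "set ys = set xs"
        using \<open>set xs \<in> C\<close> by (auto simp: C_def)
      then show ?thesis using that
        by (auto simp: increasing_tuples_def dest: strict_sorted_equal)
    qed
    obtain xs where "xs \<in> increasing_tuples n X" "xs \<in> A"
      using ultrafilter_disjoint[OF ultrafilter_uf_power[OF u] A increasing_tuples_in_uf_power[OF u np X]]
      by blast
    then have "set xs \<in> [X]\<^bsup>n\<^esup>" "set xs \<in> C"
      using increasing_tuples_mono[of X UNIV n]
      by (auto simp: C_def increasing_tuples_imp_nsets)
    then have "[X]\<^bsup>n\<^esup> \<subseteq> C" using cases by blast
    then show ?thesis using inC increasing_tuples_imp_nsets X by blast
  qed
qed

text \<open>
  The power picks one of the finitely many pieces, and every set in the power contains the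
  increasing tuples from some set in the ultrafilter.
\<close>

lemma upward_generated_imp_ramsey_ultrafilter:
  assumes u: "ultrafilter u" and np: "\<not> is_principal u" and gen: "upward_generated u"
  shows "ramsey_ultrafilter u"
  unfolding ramsey_ultrafilter_def
proof (intro conjI u np allI impI)
  fix n :: nat and \<P> :: "nat set set set"
  assume P: "weak_partition ([UNIV :: nat set]\<^bsup>n\<^esup>) \<P> \<and> finite \<P>"
  have "increasing_tuples n UNIV \<subseteq> (\<Union>C\<in>\<P>. {xs. set xs \<in> C})"
    using P increasing_tuples_imp_nsets by (fastforce simp: weak_partition_def)
  then have "(\<Union>C\<in>\<P>. {xs. set xs \<in> C}) \<in> uf_power u n"
    using ultrafilter_mono[OF ultrafilter_uf_power[OF u]]
      increasing_tuples_in_uf_power[OF u np ultrafilter_UNIV[OF u]] by blast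
  then obtain C where C: "C \<in> \<P>" "{xs. set xs \<in> C} \<in> uf_power u n"
    using ultrafilter_UN[OF ultrafilter_uf_power[OF u]] P by blast
  then obtain X where "X \<in> u" "increasing_tuples n X \<subseteq> {xs. set xs \<in> C}"
    using gen unfolding upward_generated_def by blast
  then show "\<exists>X\<in>u. homogeneous n \<P> X"
    using C by (auto simp: homogeneous_def elim!: nsetsE_increasing_tuple intro!: bexI[of _ X] bexI[of _ C])
qed

section \<open>Selective ultrafilters\<close>

definition selective :: "nat set set \<Rightarrow> bool" where
  "selective u \<longleftrightarrow> (\<forall>f :: nat \<Rightarrow> nat. \<exists>X\<in>u. (\<exists>c. \<forall>x\<in>X. f x = c) \<or> inj_on f X)"

text \<open>
  The natural numbers are cut into consecutive intervals whose lengths grow so fast that \<open>b x\<close> is at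
  most the first point of the second interval after that of \<open>x\<close>; \<open>k y\<close> is the number of the interval
  that contains \<open>y\<close>. On a set where all values of \<open>k\<close>
  have the same parity, points in distinct intervals are then far apart in the sense of \<open>b\<close>.
\<close>

lemma ex_interval_index:
  fixes b :: "nat \<Rightarrow> nat"
  obtains k :: "nat \<Rightarrow> nat" where "mono k" "\<And>i. finite {y. k y = i}"
    "\<And>x y. k x + 2 \<le> k y \<Longrightarrow> b x \<le> y"
proof -
  \<comment> \<open>The interval with number \<open>i\<close> ends just before \<open>a (Suc i)\<close>, and \<open>a (Suc i)\<close> exceeds \<open>b x\<close> for all \<open>x < a i\<close>.\<close>
  define a where "a = rec_nat 0 (\<lambda>_ t. Suc (t + (\<Sum>x<t. b x)))"
  have a_Suc: "a (Suc i) = Suc (a i + (\<Sum>x<a i. b x))" for i by (simp add: a_def)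
  have "strict_mono a" by (simp add: strict_mono_Suc_iff a_Suc)
  then have le_a: "i \<le> a i" for i by (rule strict_mono_imp_increasing)
  define k where "k y = (LEAST i. y < a (Suc i))" for y
  have less: "y < a (Suc (k y))" for y
    using LeastI[of "\<lambda>i. y < a (Suc i)" y] le_a[of "Suc y"] by (simp add: k_def)
  have not_less: "a (Suc i) \<le> y" if "i < k y" for i y
    using not_less_Least[of i "\<lambda>i. y < a (Suc i)"] that by (simp add: k_def)
  show ?thesis
  proof
    show "mono k"
    proof
      fix x y :: nat assume "x \<le> y"
      then show "k x \<le> k y"
        using Least_le[of "\<lambda>i. x < a (Suc i)" "k y"] less[of y] by (simp add: k_def[of x])
    qed
    show "finite {y. k y = i}" for i
      by (rule finite_subset[of _ "{..<a (Suc i)}"]) (use less in auto)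
    show "b x \<le> y" if "k x + 2 \<le> k y" for x y
    proof -
      have "b x \<le> (\<Sum>x<a (Suc (k x)). b x)" using less[of x] by (intro member_le_sum) auto
      also have "\<dots> \<le> a (Suc (Suc (k x)))" by (simp add: a_Suc)
      also have "\<dots> \<le> y" using that by (intro not_less) simp
      finally show ?thesis .
    qed
  qed
qed

lemma ultrafilter_fixed_parity:
  fixes k :: "'a \<Rightarrow> nat"
  assumes "ultrafilter u"
  obtains E where "E \<in> u" "\<And>x y. x \<in> E \<Longrightarrow> y \<in> E \<Longrightarrow> even (k x) \<longleftrightarrow> even (k y)"
proof (cases "{x. even (k x)} \<in> u")
  case True
  then show ?thesis by (rule that) simp
next
  case False
  then have "- {x. even (k x)} \<in> u" by (simp only: ultrafilter_Compl_iff[OF assms] not_False_eq_True)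
  then show ?thesis by (rule that) simp
qed

lemma finite_fibres_not_const:
  assumes u: "ultrafilter u" and np: "\<not> is_principal u"
    and "\<And>i. finite {y. k y = i}" and "X \<in> u"
  shows "\<not> (\<exists>c. \<forall>x\<in>X. k x = c)"
proof
  assume "\<exists>c. \<forall>x\<in>X. k x = c"
  then obtain c where "X \<subseteq> {x. k x = c}" by blast
  then have "finite X" using assms(3) finite_subset by blast
  then show False using nonprincipal_infinite[OF u np \<open>X \<in> u\<close>] by simp
qed

text \<open>
  Selectivity is used twice. Let \<open>f y\<close> be the first index \<open>i\<close> at which \<open>y\<close> drops out of a decreasing
  sequence that refines \<open>A\<close>. As \<open>f\<close> is not constant on a set of \<open>u\<close>, it is injective on one. So for
  each \<open>x\<close> only finitely many points \<open>y\<close> of that set have \<open>f y \<le> x\<close>, and all \<open>y\<close> beyond some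
  bound \<open>b x\<close> lie in \<open>A x\<close>. Selectivity applied to the intervals belonging to \<open>b\<close> gives a set that
  has at most one point in each interval; keeping every other interval makes later points reach
  the bounds of earlier ones.
\<close>

lemma selective_diagonal:
  assumes u: "ultrafilter u" and np: "\<not> is_principal u" and sel: "selective u"
    and A: "\<And>i. A i \<in> u"
  obtains X where "X \<in> u" "\<And>x y. x \<in> X \<Longrightarrow> y \<in> X \<Longrightarrow> x < y \<Longrightarrow> y \<in> A x"
proof -
  \<comment> \<open>Cutting off \<open>{..i}\<close> makes the intersection of all \<open>B i\<close> empty, so that \<open>f\<close> is defined everywhere.\<close>
  define B where "B i = (\<Inter>j\<in>{..i}. A j) \<inter> {i<..}" for i
  have B: "B i \<in> u" for i
  proof -
    have "{..i} \<notin> u" using nonprincipal_infinite[OF u np, of "{..i}"] by auto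
    then have "{i<..} \<in> u" using ultrafilter_Compl_iff[OF u, of "{..i}"] by (simp add: Compl_atMost)
    then show ?thesis
      unfolding B_def using A by (intro ultrafilter_Int[OF u] ultrafilter_INT[OF u]) auto
  qed
  define f where "f y = (LEAST i. y \<notin> B i)" for y
  have f: "y \<notin> B (f y)" for y using LeastI[of "\<lambda>i. y \<notin> B i" y] by (simp add: f_def B_def)
  have in_A: "y \<in> A x" if "x < f y" for x y
  proof -
    have "y \<in> B x" using not_less_Least[of x "\<lambda>i. y \<notin> B i"] that unfolding f_def by blast
    then show ?thesis unfolding B_def by blast
  qed
  have "\<not> (\<exists>c. \<forall>x\<in>Y. f x = c)" if Y: "Y \<in> u" for Y
  proof
    assume "\<exists>c. \<forall>x\<in>Y. f x = c"
    then obtain c where c: "\<And>x. x \<in> Y \<Longrightarrow> f x = c" by blast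
    obtain y where "y \<in> Y" "y \<in> B c" using ultrafilter_disjoint[OF u Y B] by blast
    then show False using f[of y] c[of y] by simp
  qed
  then obtain Y where Y: "Y \<in> u" "inj_on f Y" using sel unfolding selective_def by blast
  have fin: "finite {y\<in>Y. f y \<le> x}" for x
    using inj_on_subset[OF Y(2), of "{y\<in>Y. f y \<le> x}"]
    by (rule inj_on_finite[of f _ "{..x}"]) auto
  define b where "b x = Suc (\<Sum>y\<in>{y\<in>Y. f y \<le> x}. y)" for x
  have b: "x < f y" if "b x \<le> y" "y \<in> Y" for x y
  proof (rule ccontr)
    assume "\<not> x < f y"
    then have "y \<le> (\<Sum>y\<in>{y\<in>Y. f y \<le> x}. y)"
      using that fin[of x] by (intro member_le_sum) auto
    then show False using that by (simp add: b_def)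
  qed
  obtain k :: "nat \<Rightarrow> nat" where k: "mono k" "\<And>i. finite {y. k y = i}" "\<And>x y. k x + 2 \<le> k y \<Longrightarrow> b x \<le> y"
    using ex_interval_index[of b] by blast
  obtain Z where Z: "Z \<in> u" "inj_on k Z"
    using sel finite_fibres_not_const[OF u np k(2)] unfolding selective_def by blast
  obtain E where E: "E \<in> u" "\<And>x y. x \<in> E \<Longrightarrow> y \<in> E \<Longrightarrow> even (k x) \<longleftrightarrow> even (k y)"
    using ultrafilter_fixed_parity[OF u, of k] by metis
  show ?thesis
  proof
    show "Y \<inter> Z \<inter> E \<in> u" using Y Z E by (intro ultrafilter_Int[OF u])
    fix x y assume xy: "x \<in> Y \<inter> Z \<inter> E" "y \<in> Y \<inter> Z \<inter> E" "x < y"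
    have "k x \<le> k y" "k x \<noteq> k y" "even (k x) \<longleftrightarrow> even (k y)"
      using xy k(1) Z(2) E(2)[of x y] by (auto simp: monoD inj_on_def)
    then have "k x + 2 \<le> k y" by presburger
    then show "y \<in> A x" using k(3) b in_A xy by blast
  qed
qed

text \<open>
  By the induction hypothesis, for almost every first entry \<open>x\<close> the section of \<open>A\<close> at \<open>x\<close> contains the
  increasing \<open>n\<close>-tuples from some \<open>H x\<close>. If \<open>X\<close> is a diagonal intersection of the \<open>H x\<close>, the tail
  of every increasing tuple from \<open>X\<close> lies in the set \<open>H x\<close> of its first entry.
\<close>

lemma selective_imp_upward_generated:
  assumes u: "ultrafilter u" and np: "\<not> is_principal u" and sel: "selective u"
  shows "upward_generated u"
  unfolding upward_generated_def
proof (intro allI ballI)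
  fix n A assume "A \<in> uf_power u n"
  then show "\<exists>X\<in>u. increasing_tuples n X \<subseteq> A"
  proof (induction n arbitrary: A)
    case 0
    then show ?case using ultrafilter_UNIV[OF u] by (auto simp: uf_power_0 increasing_tuples_0)
  next
    case (Suc n)
    define D where "D = {x. {xs. x # xs \<in> A} \<in> uf_power u n}"
    have D: "D \<in> u" using Suc.prems by (simp add: uf_power_Suc[OF u] D_def)
    have "\<exists>H\<in>u. x \<in> D \<longrightarrow> increasing_tuples n H \<subseteq> {xs. x # xs \<in> A}" for x
      using Suc.IH[of "{xs. x # xs \<in> A}"] ultrafilter_UNIV[OF u] by (auto simp: D_def)
    then obtain H where H: "\<And>x. H x \<in> u"
        "\<And>x. x \<in> D \<Longrightarrow> increasing_tuples n (H x) \<subseteq> {xs. x # xs \<in> A}"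
      by metis
    obtain X where X: "X \<in> u" "\<And>x y. x \<in> X \<Longrightarrow> y \<in> X \<Longrightarrow> x < y \<Longrightarrow> y \<in> H x"
      using selective_diagonal[OF u np sel, of H] H(1) by blast
    have "increasing_tuples (Suc n) (X \<inter> D) \<subseteq> A"
    proof
      fix zs assume zs: "zs \<in> increasing_tuples (Suc n) (X \<inter> D)"
      then obtain x xs where [simp]: "zs = x # xs" by (cases zs) (auto simp: increasing_tuples_def)
      have x: "x \<in> X" "x \<in> D" and xs: "xs \<in> increasing_tuples n (X \<inter> D \<inter> {x<..})"
        using zs by (auto simp: Cons_increasing_tuples)
      have "X \<inter> D \<inter> {x<..} \<subseteq> H x" using X(2) x by auto
      then have "xs \<in> increasing_tuples n (H x)" using xs increasing_tuples_mono by blast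
      then show "zs \<in> A" using H(2)[OF x(2)] by auto
    qed
    then show ?case using ultrafilter_Int[OF u X(1) D] by blast
  qed
qed

section \<open>Self-maps of an ultrafilter\<close>

text \<open>
  Follow the orbit of \<open>x\<close> under \<open>g\<close> as long as \<open>m\<close> decreases. This stops after finitely many steps, and
  each application of \<open>g\<close> saves one step; \<open>c\<close> is the parity of their number.
\<close>

lemma alternating_colouring:
  fixes m :: "'a \<Rightarrow> nat"
  obtains c :: "'a \<Rightarrow> bool" where "\<And>x. m (g x) < m x \<Longrightarrow> c (g x) \<noteq> c x"
proof -
  define stop where "stop x k \<longleftrightarrow> \<not> m (g ((g ^^ k) x)) < m ((g ^^ k) x)" for x k
  have ex: "\<exists>k. stop x k" for x
  proof (induction "m x" arbitrary: x rule: less_induct)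
    case less
    show ?case
    proof (cases "m (g x) < m x")
      case True
      then obtain k where "stop (g x) k" using less by blast
      then have "stop x (Suc k)" by (simp add: stop_def funpow_swap1)
      then show ?thesis ..
    next
      case False
      then have "stop x 0" by (simp add: stop_def)
      then show ?thesis ..
    qed
  qed
  define c where "c x = even (LEAST k. stop x k)" for x
  have "c (g x) \<noteq> c x" if "m (g x) < m x" for x
  proof -
    have "\<not> stop x 0" using that by (simp add: stop_def)
    moreover have "stop x (Suc k) = stop (g x) k" for k by (simp add: stop_def funpow_swap1)
    ultimately have "(LEAST k. stop x k) = Suc (LEAST k. stop (g x) k)"
      using Least_Suc[of "stop x"] ex[of x] by auto
    then show ?thesis by (simp add: c_def)
  qed
  then show ?thesis using that by blast
qed

text \<open>
  Otherwise the ultrafilter chooses a colour of an alternating colouring, and \<open>g\<close> preserves the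
  chosen colour on a set of the ultrafilter but changes it wherever \<open>m\<close> decreases.
\<close>

lemma preserving_map_not_descending:
  fixes m :: "'a \<Rightarrow> nat"
  assumes u: "ultrafilter u" and inv: "\<And>S. S \<in> u \<Longrightarrow> g -` S \<in> u"
  shows "{x. m (g x) < m x} \<notin> u"
proof
  assume D: "{x. m (g x) < m x} \<in> u"
  obtain c :: "'a \<Rightarrow> bool" where c: "\<And>x. m (g x) < m x \<Longrightarrow> c (g x) \<noteq> c x"
    using alternating_colouring[of m g] by blast
  define C where "C = (if {x. c x} \<in> u then {x. c x} else - {x. c x})"
  have "C \<in> u" using ultrafilter_Compl_iff[OF u, of "{x. c x}"] by (auto simp: C_def)
  then have "C \<inter> g -` C \<in> u" using inv ultrafilter_Int[OF u] by blast
  then obtain x where "x \<in> C" "g x \<in> C" "m (g x) < m x"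
    using ultrafilter_disjoint[OF u D] by blast
  then show False using c[of x] by (auto simp: C_def split: if_splits)
qed

text \<open>
  The map cannot lower almost all points, as \<open>x\<close> itself would then be a decreasing measure. If it
  raises almost all points, choose intervals that \<open>g\<close> never jumps over. When the number of the
  interval has constant parity, \<open>g x\<close> stays in the interval of \<open>x\<close>, and the number of points of the
  interval above \<open>x\<close> decreases.
\<close>

lemma preserving_map_eq_id:
  fixes g :: "nat \<Rightarrow> nat"
  assumes u: "ultrafilter u" and inv: "\<And>S. S \<in> u \<Longrightarrow> g -` S \<in> u"
  shows "{x. g x = x} \<in> u"
proof (rule ccontr)
  assume not_id: "{x. g x = x} \<notin> u"
  have "{x. g x < x} \<notin> u"
    using preserving_map_not_descending[OF u inv, of "\<lambda>x. x"] by simp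
  then have "- {x. g x = x} \<inter> - {x. g x < x} \<in> u"
    using not_id by (intro ultrafilter_Int[OF u]) (auto simp: ultrafilter_Compl_iff[OF u])
  moreover have "- {x. g x = x} \<inter> - {x. g x < x} = {x. x < g x}" by auto
  ultimately have up: "{x. x < g x} \<in> u" by simp
  obtain k :: "nat \<Rightarrow> nat" where k: "mono k" "\<And>i. finite {y. k y = i}" "\<And>x y. k x + 2 \<le> k y \<Longrightarrow> Suc (g x) \<le> y"
    using ex_interval_index[of "\<lambda>x. Suc (g x)"] by blast
  obtain E where E: "E \<in> u" "\<And>x y. x \<in> E \<Longrightarrow> y \<in> E \<Longrightarrow> even (k x) \<longleftrightarrow> even (k y)"
    using ultrafilter_fixed_parity[OF u, of k] by metis
  define m where "m x = card {y. k y = k x \<and> x < y}" for x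
  have "m (g x) < m x" if x: "x \<in> E" "g x \<in> E" "x < g x" for x
  proof -
    have "k x \<le> k (g x)" using k(1) x(3) by (simp add: monoD)
    moreover have "\<not> k x + 2 \<le> k (g x)" using k(3)[of x "g x"] by auto
    moreover have "even (k x) \<longleftrightarrow> even (k (g x))" using E(2) x by blast
    ultimately have "k (g x) = k x" by presburger
    then have "{y. k y = k (g x) \<and> g x < y} \<subset> {y. k y = k x \<and> x < y}" using x(3) by auto
    moreover have "finite {y. k y = k x \<and> x < y}" using k(2)[of "k x"] by simp
    ultimately show ?thesis unfolding m_def by (intro psubset_card_mono)
  qed
  then have "E \<inter> g -` E \<inter> {x. x < g x} \<subseteq> {x. m (g x) < m x}" by auto
  moreover have "E \<inter> g -` E \<inter> {x. x < g x} \<in> u"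
    using E(1) inv up ultrafilter_Int[OF u] by blast
  ultimately show False
    using preserving_map_not_descending[OF u inv, of m] ultrafilter_mono[OF u] by blast
qed

text \<open>
  That some injection exists at all, so that the choice in the definition of the product is a
  genuine one, is witnessed by the standard coding of lists.
\<close>

lemma uf_prod_injectionE:
  obtains e :: "nat list \<Rightarrow> nat"
  where "inj_on e {xs. length xs = length us}" "uf_prod us = uf_ext e us"
proof
  let ?P = "\<lambda>g :: nat list \<Rightarrow> nat. inj_on g {xs. length xs = length us}"
  have "?P list_encode" by (rule inj_list_encode)
  then show "?P (SOME g. ?P g)" by (rule someI[of ?P])
  show "uf_prod us = uf_ext (SOME g. ?P g) us" by (simp add: uf_prod_def)
qed

text \<open>
  If \<open>f(u)\<close> is not principal, it can be mapped back to \<open>u\<close>. The composition of \<open>f\<close> with that map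
  preserves \<open>u\<close>, so it is the identity on a set of \<open>u\<close>, and \<open>f\<close> is injective there.
\<close>

lemma RK_minimal_imp_selective:
  assumes u: "ultrafilter u"
    and min: "\<And>f :: nat list \<Rightarrow> nat.
      is_principal (uf_ext f [u]) \<or> uf_ext f [u] \<approx>\<^sub>R\<^sub>K uf_prod [u]"
  shows "selective u"
  unfolding selective_def
proof
  fix f :: "nat \<Rightarrow> nat"
  define v where "v = uf_ext (\<lambda>xs. f (hd xs)) [u]"
  have v: "ultrafilter v" unfolding v_def using u by (intro ultrafilter_uf_ext) simp
  have in_v: "S \<in> v \<longleftrightarrow> f -` S \<in> u" for S unfolding v_def by (rule uf_ext_unary_iff[OF u])
  show "\<exists>X\<in>u. (\<exists>c. \<forall>x\<in>X. f x = c) \<or> inj_on f X"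
  proof (cases "is_principal v")
    case True
    then obtain c where "f -` {c} \<in> u" using in_v by (auto simp: is_principal_def principal_uf_def)
    moreover have "\<forall>x\<in>f -` {c}. f x = c" by simp
    ultimately show ?thesis by blast
  next
    case False
    then have "v \<approx>\<^sub>R\<^sub>K uf_prod [u]" using min unfolding v_def by blast
    then obtain h where h: "uf_ext (\<lambda>xs. h (hd xs)) [v] = uf_prod [u]"
      unfolding rk_equiv_def rk_le_def by blast
    obtain e where e: "inj_on e {xs. length xs = length [u]}" "uf_prod [u] = uf_ext e [u]"
      by (rule uf_prod_injectionE)
    have inj: "inj (\<lambda>x. e [x])"
    proof (rule injI)
      fix x y assume "e [x] = e [y]"
      then have "[x] = [y]" by (intro inj_onD[OF e(1)]) simp_all
      then show "x = y" by simp
    qed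
    have prod: "S \<in> uf_prod [u] \<longleftrightarrow> (\<lambda>x. e [x]) -` S \<in> u" for S
    proof -
      have "uf_prod [u] = uf_ext (\<lambda>xs. e [hd xs]) [u]"
        unfolding e(2) by (rule uf_ext_cong) (auto simp: length_Suc_conv)
      then show ?thesis using uf_ext_unary_iff[OF u, of S "\<lambda>x. e [x]"] by simp
    qed
    define g where "g x = inv (\<lambda>x. e [x]) (h (f x))" for x
    have "g -` S \<in> u" if "S \<in> u" for S
    proof -
      have "(\<lambda>x. e [x]) -` (inv (\<lambda>x. e [x]) -` S) = S"
        by (simp add: vimage_def inv_f_f[OF inj])
      then have "inv (\<lambda>x. e [x]) -` S \<in> uf_prod [u]" using prod that by simp
      then have "f -` (h -` (inv (\<lambda>x. e [x]) -` S)) \<in> u"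
        by (simp only: h[symmetric] uf_ext_unary_iff[OF v] in_v)
      then show ?thesis by (simp add: g_def vimage_def)
    qed
    then have "{x. g x = x} \<in> u" by (rule preserving_map_eq_id[OF u])
    moreover have "inj_on f {x. g x = x}"
      by (rule inj_onI) (metis (full_types) g_def mem_Collect_eq)
    ultimately show ?thesis by blast
  qed
qed

section \<open>Rudin-Keisler classes of images\<close>

text \<open>
  On \<open>A\<close> the map \<open>G\<close> factors through \<open>F\<close>, and points outside \<open>A\<close> do not influence the images.
\<close>

lemma images_rk_le:
  fixes F G :: "nat list \<Rightarrow> nat"
  assumes u: "ultrafilter u" and A: "A \<in> uf_power u n"
    and ker: "\<And>x y. x \<in> A \<Longrightarrow> y \<in> A \<Longrightarrow> F x = F y \<Longrightarrow> G x = G y"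
  shows "uf_ext G (replicate n u) \<le>\<^sub>R\<^sub>K uf_ext F (replicate n u)"
proof -
  define h where "h y = G (inv_into A F y)" for y
  have h: "h (F x) = G x" if "x \<in> A" for x
    unfolding h_def using that by (intro ker) (auto intro: inv_into_into f_inv_into_f)
  have u': "ultrafilter (uf_ext F (replicate n u))" using u by (intro ultrafilter_uf_ext) simp
  have V: "ultrafilter (uf_power u n)" by (rule ultrafilter_uf_power[OF u])
  have "F -` (h -` S) \<in> uf_power u n \<longleftrightarrow> G -` S \<in> uf_power u n" for S
  proof -
    have "F -` (h -` S) \<inter> A = G -` S \<inter> A" using h by auto
    then show ?thesis
      using ultrafilter_Int[OF V _ A] ultrafilter_mono[OF V] by (metis Int_lower1)
  qed
  then have "uf_ext (\<lambda>xs. h (hd xs)) [uf_ext F (replicate n u)] = uf_ext G (replicate n u)"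
    by (intro set_eqI) (simp only: uf_ext_unary_iff[OF u'] uf_ext_replicate_iff[OF u])
  then show ?thesis unfolding rk_le_def by blast
qed

text \<open>
  Projecting the \<open>n\<close>-th power to the coordinates in \<open>J\<close> gives a power again: a quantifier \<open>for
  almost all x\<close> over a coordinate outside \<open>J\<close> is vacuous.
\<close>

lemma uf_power_nths:
  assumes u: "ultrafilter u"
  shows "J \<subseteq> {..<n} \<Longrightarrow> (\<lambda>xs. nths xs J) -` A \<in> uf_power u n \<longleftrightarrow> A \<in> uf_power u (card J)"
proof (induction n arbitrary: J A)
  case 0
  then show ?case by (simp add: uf_power_0)
next
  case (Suc n)
  \<comment> \<open>The set of coordinates of the tail that are kept.\<close>
  define J' where "J' = {j. Suc j \<in> J}"
  have J': "J' \<subseteq> {..<n}" using Suc.prems by (auto simp: J'_def)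
  have J: "J = (if 0 \<in> J then insert 0 (Suc ` J') else Suc ` J')"
    by (auto simp: J'_def image_iff gr0_conv_Suc not_less_eq elim: nat.exhaust) (metis nat.exhaust)+
  have card: "card J = (if 0 \<in> J then Suc (card J') else card J')"
    using finite_subset[OF J'] by (subst J) (auto simp: card_image)
  have "{xs. x # xs \<in> (\<lambda>xs. nths xs J) -` A}
      = (\<lambda>xs. nths xs J') -` (if 0 \<in> J then {xs. x # xs \<in> A} else A)" for x
    by (auto simp: nths_Cons J'_def)
  then have "(\<lambda>xs. nths xs J) -` A \<in> uf_power u (Suc n) \<longleftrightarrow>
      {x. (if 0 \<in> J then {xs. x # xs \<in> A} else A) \<in> uf_power u (card J')} \<in> u"
    by (simp only: uf_power_Suc[OF u] Suc.IH[OF J'])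
  also have "\<dots> \<longleftrightarrow> A \<in> uf_power u (card J)"
    using ultrafilter_UNIV[OF u] ultrafilterD(2)[OF u] by (auto simp: card uf_power_Suc[OF u])
  finally show ?case .
qed

lemma nths_eq_iff:
  "length xs = length ys \<Longrightarrow> nths xs J = nths ys J \<longleftrightarrow> (\<forall>i\<in>J. i < length xs \<longrightarrow> xs ! i = ys ! i)"
proof (induction xs ys arbitrary: J rule: list_induct2)
  case (Cons x xs y ys)
  have "(\<forall>i\<in>J. i < length (x # xs) \<longrightarrow> (x # xs) ! i = (y # ys) ! i) \<longleftrightarrow>
      (0 \<in> J \<longrightarrow> x = y) \<and> (\<forall>i\<in>{j. Suc j \<in> J}. i < length xs \<longrightarrow> xs ! i = ys ! i)"
    by (auto simp: nth_Cons split: nat.splits)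
  then show ?case using Cons by (auto simp: nths_Cons)
qed simp

text \<open>
  On increasing tuples from \<open>X\<close>, the function \<open>f\<close> has the same kernel as the coding of the
  subtuple given by \<open>J\<close>, and the image under the latter is the product.
\<close>

lemma sel_upward_inj_wrt_imp_product:
  assumes u: "ultrafilter u" and np: "\<not> is_principal u" and X: "X \<in> u"
    and J: "J \<subseteq> {..<n}" and f: "sel_upward_inj_wrt n f X J"
  shows "uf_ext f (replicate n u) \<approx>\<^sub>R\<^sub>K uf_prod (replicate (card J) u)"
proof -
  obtain e where e: "inj_on e {xs. length xs = length (replicate (card J) u)}"
      "uf_prod (replicate (card J) u) = uf_ext e (replicate (card J) u)"
    by (rule uf_prod_injectionE)
  then have inj: "inj_on e {xs. length xs = card J}" by simp
  define G where "G xs = e (nths xs J)" for xs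
  have prod: "uf_prod (replicate (card J) u) = uf_ext G (replicate n u)"
  proof (rule set_eqI)
    fix S
    have "S \<in> uf_prod (replicate (card J) u) \<longleftrightarrow> e -` S \<in> uf_power u (card J)"
      unfolding e(2) by (rule uf_ext_replicate_iff[OF u])
    also have "\<dots> \<longleftrightarrow> G -` S \<in> uf_power u n"
      using uf_power_nths[OF u J, of "e -` S"] by (simp add: G_def vimage_def)
    finally show "S \<in> uf_prod (replicate (card J) u) \<longleftrightarrow> S \<in> uf_ext G (replicate n u)"
      by (simp only: uf_ext_replicate_iff[OF u])
  qed
  have ker: "f xs = f ys \<longleftrightarrow> G xs = G ys"
    if "xs \<in> increasing_tuples n X" "ys \<in> increasing_tuples n X" for xs ys
  proof -
    have len: "length xs = n" "length ys = n" using that by (auto simp: increasing_tuples_def)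
    have "{i. i < n \<and> i \<in> J} = J" using J by auto
    then have "G xs = G ys \<longleftrightarrow> nths xs J = nths ys J"
      unfolding G_def using inj len by (intro inj_on_eq_iff[OF inj]) (auto simp: length_nths)
    also have "\<dots> \<longleftrightarrow> (\<forall>i\<in>J. xs ! i = ys ! i)"
      using J len by (subst nths_eq_iff) auto
    finally show ?thesis using f that by (simp add: sel_upward_inj_wrt_def)
  qed
  have A: "increasing_tuples n X \<in> uf_power u n" by (rule increasing_tuples_in_uf_power[OF u np X])
  show ?thesis
    unfolding rk_equiv_def prod using images_rk_le[OF u A] ker by blast
qed

lemma upward_const_imp_principal:
  assumes u: "ultrafilter u" and np: "\<not> is_principal u" and X: "X \<in> u"
    and f: "upward_const n f X"
  shows "is_principal (uf_ext f (replicate n u))"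
proof -
  have V: "ultrafilter (uf_power u n)" by (rule ultrafilter_uf_power[OF u])
  have A: "increasing_tuples n X \<in> uf_power u n" by (rule increasing_tuples_in_uf_power[OF u np X])
  obtain xs where "xs \<in> increasing_tuples n X"
    using increasing_tuples_infinite[OF nonprincipal_infinite[OF u np X]] by blast
  then have c: "f ys = f xs" if "ys \<in> increasing_tuples n X" for ys
    using f that unfolding upward_const_def sel_upward_inj_wrt_def by blast
  have "f -` S \<in> uf_power u n \<longleftrightarrow> f xs \<in> S" for S
  proof
    assume "f -` S \<in> uf_power u n"
    then show "f xs \<in> S" using ultrafilter_disjoint[OF V A] c by fastforce
  next
    assume "f xs \<in> S"
    then show "f -` S \<in> uf_power u n" by (intro ultrafilter_mono[OF V A]) (auto simp: c)
  qed
  then have "uf_ext f (replicate n u) = principal_uf (f xs)"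
    by (intro set_eqI) (simp only: uf_ext_replicate_iff[OF u] principal_uf_def mem_Collect_eq)
  then show ?thesis by (auto simp: is_principal_def)
qed

section \<open>The canonical Ramsey theorem\<close>

text \<open>
  The pair \<open>(P, Q)\<close> of increasing tuples of natural numbers serves as an order pattern, and a
  strictly increasing \<open>\<phi>\<close> realises it in \<open>X\<close>. The condition says that whether \<open>f\<close> identifies two tuples
  from \<open>X\<close> depends only on their relative position.
\<close>

definition pattern_invariant :: "nat \<Rightarrow> (nat list \<Rightarrow> 'b) \<Rightarrow> nat set \<Rightarrow> bool" where
  "pattern_invariant n f X \<longleftrightarrow>
     (\<forall>P\<in>increasing_tuples n UNIV. \<forall>Q\<in>increasing_tuples n UNIV. \<forall>\<phi> \<psi>.
        strict_mono_on (set P \<union> set Q) \<phi> \<and> \<phi> ` (set P \<union> set Q) \<subseteq> X \<and>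
        strict_mono_on (set P \<union> set Q) \<psi> \<and> \<psi> ` (set P \<union> set Q) \<subseteq> X \<longrightarrow>
        (f (map \<phi> P) = f (map \<phi> Q) \<longleftrightarrow> f (map \<psi> P) = f (map \<psi> Q)))"

lemma increasing_tuples_iff_nth:
  "xs \<in> increasing_tuples n X \<longleftrightarrow>
     length xs = n \<and> (\<forall>i<n. xs ! i \<in> X) \<and> (\<forall>i j. i < j \<longrightarrow> j < n \<longrightarrow> xs ! i < xs ! j)"
  unfolding increasing_tuples_def sorted_wrt_iff_nth_less by (auto simp: set_conv_nth subset_iff)

lemma increasing_tuple_as_nths:
  assumes P: "P \<in> increasing_tuples n UNIV" and W: "strict_sorted W" "set P \<subseteq> set W"
  obtains A where "A \<subseteq> {..<length W}" "nths W A = P"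
proof
  show "{i. i < length W \<and> W ! i \<in> set P} \<subseteq> {..<length W}" by auto
  have "filter (\<lambda>x. x \<in> set P) W = P"
    using P W by (intro strict_sorted_equal) (auto simp: increasing_tuples_def intro: sorted_wrt_filter)
  then show "nths W {i. i < length W \<and> W ! i \<in> set P} = P" by (simp add: filter_eq_nths)
qed

text \<open>
  The relative position of two \<open>n\<close>-tuples is given by the number \<open>k \<le> 2 * n\<close> of points that they
  occupy and by the sets \<open>A\<close>, \<open>B\<close> of places that they take in the increasing list of these points.
  For each of the finitely many triples \<open>(k, A, B)\<close>, a set of \<open>u\<close> decides whether \<open>f\<close> identifies the
  two subtuples; intersect these sets.
\<close>

lemma upward_generated_imp_pattern_invariant:
  assumes u: "ultrafilter u" and gen: "upward_generated u"
  obtains X where "X \<in> u" "pattern_invariant n f X"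
proof -
  have decide: "\<exists>X\<in>u. increasing_tuples k X \<subseteq> R \<or> increasing_tuples k X \<subseteq> - R" for k R
  proof (cases "R \<in> uf_power u k")
    case True
    then show ?thesis using gen unfolding upward_generated_def by blast
  next
    case False
    then have "- R \<in> uf_power u k"
      using ultrafilter_Compl_iff[OF ultrafilter_uf_power[OF u]] by blast
    then show ?thesis using gen unfolding upward_generated_def by blast
  qed
  define R where "R A B = {zs. f (nths zs A) = f (nths zs B)}" for A B
  have "\<forall>k A B. \<exists>X\<in>u. increasing_tuples k X \<subseteq> R A B \<or> increasing_tuples k X \<subseteq> - R A B"
    using decide by blast
  then obtain H where H: "\<And>k A B. H k A B \<in> u"
      "\<And>k A B. increasing_tuples k (H k A B) \<subseteq> R A B \<or> increasing_tuples k (H k A B) \<subseteq> - R A B"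
    by metis
  define T where "T = {..2 * n} \<times> Pow {..<2 * n} \<times> Pow {..<2 * n}"
  define X where "X = (\<Inter>(k, A, B)\<in>T. H k A B)"
  have X: "X \<in> u"
    unfolding X_def by (rule ultrafilter_INT[OF u]) (auto simp: T_def H(1))
  have agree: "f (nths zs A) = f (nths zs B) \<longleftrightarrow> f (nths zs' A) = f (nths zs' B)"
    if t: "(k, A, B) \<in> T" and zs: "zs \<in> increasing_tuples k X" "zs' \<in> increasing_tuples k X"
    for k A B zs zs'
  proof -
    have "X \<subseteq> H k A B" using t by (auto simp: X_def)
    then have "zs \<in> increasing_tuples k (H k A B)" "zs' \<in> increasing_tuples k (H k A B)"
      using zs increasing_tuples_mono by blast+
    then have "zs \<in> R A B \<longleftrightarrow> zs' \<in> R A B" using H(2)[of k A B] by blast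
    then show ?thesis by (simp add: R_def)
  qed
  have "pattern_invariant n f X"
    unfolding pattern_invariant_def
  proof (intro ballI allI impI, elim conjE)
    fix P Q and \<phi> \<psi> :: "nat \<Rightarrow> nat"
    assume P: "P \<in> increasing_tuples n UNIV" and Q: "Q \<in> increasing_tuples n UNIV"
      and \<phi>: "strict_mono_on (set P \<union> set Q) \<phi>" "\<phi> ` (set P \<union> set Q) \<subseteq> X"
      and \<psi>: "strict_mono_on (set P \<union> set Q) \<psi>" "\<psi> ` (set P \<union> set Q) \<subseteq> X"
    define W where "W = sorted_list_of_set (set P \<union> set Q)"
    have W: "strict_sorted W" "set W = set P \<union> set Q" "length W = card (set P \<union> set Q)"
      by (simp_all add: W_def)
    have len: "length W \<le> 2 * n"
      using card_Un_le[of "set P" "set Q"] card_length[of P] card_length[of Q] P Q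
      by (simp add: W(3) increasing_tuples_def)
    obtain A where A: "A \<subseteq> {..<length W}" "nths W A = P"
      by (rule increasing_tuple_as_nths[OF P W(1)]) (auto simp: W(2))
    obtain B where B: "B \<subseteq> {..<length W}" "nths W B = Q"
      by (rule increasing_tuple_as_nths[OF Q W(1)]) (auto simp: W(2))
    have "(length W, A, B) \<in> T" using A(1) B(1) len by (auto simp: T_def)
    moreover have "W \<in> increasing_tuples (length W) UNIV" using W(1) by (simp add: increasing_tuples_def)
    then have "map \<phi> W \<in> increasing_tuples (length W) X" "map \<psi> W \<in> increasing_tuples (length W) X"
      using \<phi> \<psi> by (auto intro!: map_increasing_tuples simp: W(2) image_subset_iff)
    ultimately show "f (map \<phi> P) = f (map \<phi> Q) \<longleftrightarrow> f (map \<psi> P) = f (map \<psi> Q)"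
      using agree[of "length W" A B "map \<phi> W" "map \<psi> W"] by (simp add: nths_map A(2) B(2))
  qed
  then show ?thesis using X that by blast
qed

lemma pattern_invariantD:
  assumes "pattern_invariant n f X"
    and "P \<in> increasing_tuples n UNIV" "Q \<in> increasing_tuples n UNIV"
    and "strict_mono_on (set P \<union> set Q) \<phi>" "\<phi> ` (set P \<union> set Q) \<subseteq> X"
    and "strict_mono_on (set P \<union> set Q) \<psi>" "\<psi> ` (set P \<union> set Q) \<subseteq> X"
  shows "f (map \<phi> P) = f (map \<phi> Q) \<longleftrightarrow> f (map \<psi> P) = f (map \<psi> Q)"
  using assms unfolding pattern_invariant_def by blast

text \<open>
  The coordinate \<open>i\<close> may be changed without changing \<open>f\<close>, as long as the tuple stays increasing.
\<close>

definition ignores :: "nat \<Rightarrow> (nat list \<Rightarrow> 'b) \<Rightarrow> nat set \<Rightarrow> nat \<Rightarrow> bool" where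
  "ignores n f X i \<longleftrightarrow>
     (\<forall>xs\<in>increasing_tuples n X. \<forall>v. xs[i := v] \<in> increasing_tuples n X \<longrightarrow> f (xs[i := v]) = f xs)"

text \<open>
  All pairs of tuples from \<open>X\<close> of which the second arises by raising coordinate \<open>i\<close> have one
  pattern: even numbers are the points of the first tuple, and \<open>2 * i + 1\<close> is the raised coordinate.
\<close>

lemma increase_effect_uniform:
  assumes inv: "pattern_invariant n f X" and i: "i < n"
    and xs: "xs \<in> increasing_tuples n X" "xs[i := v] \<in> increasing_tuples n X" "xs ! i < v"
    and ys: "ys \<in> increasing_tuples n X" "ys[i := w] \<in> increasing_tuples n X" "ys ! i < w"
  shows "f (xs[i := v]) = f xs \<longleftrightarrow> f (ys[i := w]) = f ys"
proof -
  define P where "P = map (\<lambda>j. 2 * j) [0..<n]"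
  define Q where "Q = P[i := 2 * i + 1]"
  define \<psi> where "\<psi> zs t y = (if odd y then t else zs ! (y div 2))" for zs :: "nat list" and t y :: nat
  define S where "S = insert (2 * i + 1) ((\<lambda>j. 2 * j) ` {..<n})"
  have P: "P \<in> increasing_tuples n UNIV" by (auto simp: P_def increasing_tuples_iff_nth)
  have Q: "Q \<in> increasing_tuples n UNIV"
    using i by (auto simp: P_def Q_def increasing_tuples_iff_nth nth_list_update)
  have sub: "set P \<union> set Q \<subseteq> S"
    using set_update_subset_insert[of P i "2 * i + 1"] by (auto simp: P_def Q_def S_def)
  have place: "strict_mono_on (set P \<union> set Q) (\<psi> zs t) \<and> \<psi> zs t ` (set P \<union> set Q) \<subseteq> X
      \<and> map (\<psi> zs t) P = zs \<and> map (\<psi> zs t) Q = zs[i := t]"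
    if zs: "zs \<in> increasing_tuples n X" "zs[i := t] \<in> increasing_tuples n X" "zs ! i < t" for zs t
  proof -
    have len: "length zs = n" using zs(1) by (simp add: increasing_tuples_def)
    have less: "zs ! j < zs ! k" if "j < k" "k < n" for j k
      using zs(1) that by (simp add: increasing_tuples_iff_nth)
    have t_less: "t < zs ! k" if "i < k" "k < n" for k
    proof -
      have "zs[i := t] ! i < zs[i := t] ! k" using zs(2) that unfolding increasing_tuples_iff_nth by blast
      then show ?thesis using that len i by simp
    qed
    have less_t: "zs ! j < t" if "j \<le> i" for j
      using less[of j i] zs(3) that i by (cases "j = i") auto
    have "strict_mono_on S (\<psi> zs t)"
      by (rule strict_mono_onI) (auto simp: S_def \<psi>_def intro!: less t_less less_t)
    then have 1: "strict_mono_on (set P \<union> set Q) (\<psi> zs t)"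
      using sub unfolding strict_mono_on_def by blast
    have P': "map (\<psi> zs t) P = zs" by (simp add: P_def \<psi>_def comp_def len[symmetric] map_nth)
    then have Q': "map (\<psi> zs t) Q = zs[i := t]" by (simp add: Q_def map_update \<psi>_def)
    have "\<psi> zs t ` set P = set zs" "\<psi> zs t ` set Q = set (zs[i := t])"
      using arg_cong[OF P', of set] arg_cong[OF Q', of set] by (simp_all only: set_map)
    then have "\<psi> zs t ` (set P \<union> set Q) \<subseteq> X"
      using zs by (simp add: image_Un increasing_tuples_def)
    then show ?thesis using 1 P' Q' by blast
  qed
  show ?thesis
    using pattern_invariantD[OF inv P Q, of "\<psi> xs v" "\<psi> ys w"] place[OF xs] place[OF ys] by auto
qed

text \<open>
  Lowering a coordinate is the inverse of raising it, so a single change of coordinate \<open>i\<close> that keeps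
  the value of \<open>f\<close> already shows that no such change matters.
\<close>

lemma ignores_if_one_change:
  assumes inv: "pattern_invariant n f X" and i: "i < n"
    and xs: "xs \<in> increasing_tuples n X" "xs[i := v] \<in> increasing_tuples n X" "v \<noteq> xs ! i"
    and eq: "f (xs[i := v]) = f xs"
  shows "ignores n f X i"
proof -
  have up: "\<exists>zs t. zs \<in> increasing_tuples n X \<and> zs[i := t] \<in> increasing_tuples n X \<and> zs ! i < t \<and>
      (f (zs[i := t]) = f zs \<longleftrightarrow> f (ys[i := w]) = f ys)"
    if ys: "ys \<in> increasing_tuples n X" "ys[i := w] \<in> increasing_tuples n X" "w \<noteq> ys ! i" for ys w
  proof (cases "ys ! i < w")
    case True
    then show ?thesis using ys by blast
  next
    case False
    have "i < length ys" using ys(1) i by (simp add: increasing_tuples_def)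
    then have "(ys[i := w])[i := ys ! i] = ys" "(ys[i := w]) ! i < ys ! i"
      using False ys(3) by auto
    then show ?thesis using ys by (metis (full_types))
  qed
  obtain zs t where zs: "zs \<in> increasing_tuples n X" "zs[i := t] \<in> increasing_tuples n X" "zs ! i < t"
      "f (zs[i := t]) = f zs"
    using up[OF xs] eq by blast
  have "f (ys[i := w]) = f ys"
    if ys: "ys \<in> increasing_tuples n X" "ys[i := w] \<in> increasing_tuples n X" for ys w
  proof (cases "w = ys ! i")
    case True
    then show ?thesis by simp
  next
    case False
    then show ?thesis using up[OF ys False] increase_effect_uniform[OF inv i zs(1-3)] zs(4) by blast
  qed
  then show ?thesis unfolding ignores_def by blast
qed

text \<open>
  Raise the coordinates of \<open>p\<close> to those of \<open>r\<close> one by one, starting with the last, so that all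
  intermediate tuples are increasing.
\<close>

lemma eq_if_agree_and_le:
  assumes p: "p \<in> increasing_tuples n X" and r: "r \<in> increasing_tuples n X"
    and le: "\<And>i. i < n \<Longrightarrow> p ! i \<le> r ! i"
    and agree: "\<And>i. i < n \<Longrightarrow> \<not> ignores n f X i \<Longrightarrow> p ! i = r ! i"
  shows "f p = f r"
proof -
  \<comment> \<open>The coordinates from \<open>k\<close> on have been raised.\<close>
  define s where "s k = map (\<lambda>j. if j < k then p ! j else r ! j) [0..<n]" for k
  have s: "s k \<in> increasing_tuples n X" for k
    unfolding increasing_tuples_iff_nth
  proof (intro conjI allI impI)
    fix i j assume "i < j" "j < n"
    then have "p ! i < p ! j" "r ! i < r ! j" "p ! j \<le> r ! j"
      using p r le by (auto simp: increasing_tuples_iff_nth)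
    then show "s k ! i < s k ! j" using \<open>i < j\<close> \<open>j < n\<close> by (auto simp: s_def)
  qed (use p r in \<open>auto simp: s_def increasing_tuples_iff_nth\<close>)
  have "k \<le> n \<Longrightarrow> f (s k) = f r" for k
  proof (induction k)
    case 0
    have "s 0 = r" using r by (auto simp: s_def increasing_tuples_def intro: nth_equalityI)
    then show ?case by simp
  next
    case (Suc k)
    then have k: "k < n" by simp
    have step: "s k = (s (Suc k))[k := r ! k]"
      by (rule nth_equalityI) (auto simp: s_def nth_list_update)
    have "f (s k) = f (s (Suc k))"
    proof (cases "ignores n f X k")
      case True
      then show ?thesis using s[of k] s[of "Suc k"] step unfolding ignores_def by metis
    next
      case False
      then have "s (Suc k) ! k = r ! k" using agree[OF k] k by (simp add: s_def)
      then show ?thesis using step by (metis list_update_id)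
    qed
    then show ?case using Suc by simp
  qed
  moreover have "s n = p" using p by (auto simp: s_def increasing_tuples_def intro: nth_equalityI)
  ultimately show ?thesis by (metis order_refl)
qed

text \<open>
  The pointwise maximum is an increasing tuple above both \<open>p\<close> and \<open>q\<close> that agrees with them wherever
  they agree with each other. Unlike a direct passage from \<open>p\<close> to \<open>q\<close>, this needs no spare elements
  of \<open>X\<close> between their entries.
\<close>

lemma eq_if_agree:
  assumes p: "p \<in> increasing_tuples n X" and q: "q \<in> increasing_tuples n X"
    and agree: "\<And>i. i < n \<Longrightarrow> \<not> ignores n f X i \<Longrightarrow> p ! i = q ! i"
  shows "f p = f q"
proof -
  define r where "r = map (\<lambda>i. max (p ! i) (q ! i)) [0..<n]"
  have r: "r \<in> increasing_tuples n X"
    unfolding increasing_tuples_iff_nth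
  proof (intro conjI allI impI)
    fix i j assume "i < j" "j < n"
    then have "p ! i < p ! j" "q ! i < q ! j" using p q by (auto simp: increasing_tuples_iff_nth)
    then show "r ! i < r ! j" using \<open>i < j\<close> \<open>j < n\<close> by (auto simp: r_def)
  qed (use p q in \<open>auto simp: r_def increasing_tuples_iff_nth max_def\<close>)
  have "f p = f r" by (rule eq_if_agree_and_le[OF p r]) (auto simp: r_def agree)
  moreover have "f q = f r" by (rule eq_if_agree_and_le[OF q r]) (auto simp: r_def agree)
  ultimately show ?thesis by simp
qed

text \<open>
  Realise the pattern of \<open>(p, q)\<close> with gaps, and move the point that represents \<open>p ! i\<close> into the
  next gap. The pattern does not change, so \<open>f\<close> identifies the two tuples before and after the move.
  The move changes the value of \<open>f\<close> at the first tuple. So it also changes the value at the second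
  tuple, which is possible only if that point is one of its relevant coordinates.
\<close>

lemma eq_imp_matching_coordinate:
  assumes inv: "pattern_invariant n f X" and X: "infinite X"
    and p: "p \<in> increasing_tuples n X" and q: "q \<in> increasing_tuples n X" and eq: "f p = f q"
    and i: "i < n" "\<not> ignores n f X i"
  shows "\<exists>j<n. \<not> ignores n f X j \<and> q ! j = p ! i"
proof (rule ccontr)
  assume none: "\<not> ?thesis"
  define e where "e = enumerate X"
  \<comment> \<open>The elements of \<open>X\<close> with odd index are the gaps; \<open>\<psi>\<close> moves one point into its gap.\<close>
  define \<phi> where "\<phi> x = e (2 * x)" for x
  define \<psi> where "\<psi> x = e (if x = p ! i then 2 * x + 1 else 2 * x)" for x
  have mono: "strict_mono_on S \<phi>" "strict_mono_on S \<psi>" for S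
    using X by (auto simp: strict_mono_on_def \<phi>_def \<psi>_def e_def)
  have ran: "\<phi> ` S \<subseteq> X" "\<psi> ` S \<subseteq> X" for S
    using enumerate_in_set[OF X] by (auto simp: \<phi>_def \<psi>_def e_def)
  have tuples: "map \<phi> xs \<in> increasing_tuples n X" "map \<psi> xs \<in> increasing_tuples n X"
    if "xs \<in> increasing_tuples n X" for xs
    by (rule map_increasing_tuples[OF that mono(1) ran(1)], rule map_increasing_tuples[OF that mono(2) ran(2)])
  have shift: "map \<psi> xs = (map \<phi> xs)[j := e (2 * p ! i + 1)]"
    if xs: "xs \<in> increasing_tuples n X" "j < n" "xs ! j = p ! i" for xs j
  proof (rule nth_equalityI)
    fix l assume "l < length (map \<psi> xs)"
    then have l: "l < n" "length xs = n" using xs(1) by (auto simp: increasing_tuples_def)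
    have "xs ! l \<noteq> xs ! j" if "l \<noteq> j"
      using xs(1,2) l(1) that by (auto simp: increasing_tuples_iff_nth neq_iff)
    then show "map \<psi> xs ! l = (map \<phi> xs)[j := e (2 * p ! i + 1)] ! l"
      using l xs by (auto simp: nth_list_update \<phi>_def \<psi>_def)
  qed simp
  have UNIV: "p \<in> increasing_tuples n UNIV" "q \<in> increasing_tuples n UNIV"
    using p q increasing_tuples_mono by blast+
  have id: "strict_mono_on (set p \<union> set q) id" "id ` (set p \<union> set q) \<subseteq> X"
    using p q by (auto simp: strict_mono_on_def increasing_tuples_def)
  have "f (map \<phi> p) = f (map \<phi> q)" "f (map \<psi> p) = f (map \<psi> q)"
    using pattern_invariantD[OF inv UNIV id mono(1) ran(1)]
      pattern_invariantD[OF inv UNIV id mono(2) ran(2)] eq by simp_all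
  moreover have "f (map \<psi> q) = f (map \<phi> q)"
  proof (cases "p ! i \<in> set q")
    case True
    then obtain j where j: "j < n" "q ! j = p ! i"
      using q by (auto simp: in_set_conv_nth increasing_tuples_def)
    then have "ignores n f X j" using none by blast
    then show ?thesis
      using tuples[OF q] shift[OF q j] unfolding ignores_def by metis
  next
    case False
    then have "map \<psi> q = map \<phi> q" by (auto simp: \<phi>_def \<psi>_def)
    then show ?thesis by (rule arg_cong)
  qed
  ultimately have "f ((map \<phi> p)[i := e (2 * p ! i + 1)]) = f (map \<phi> p)"
    using shift[OF p i(1)] by simp
  moreover have "e (2 * p ! i + 1) \<noteq> map \<phi> p ! i"
    using p i(1) X by (simp add: increasing_tuples_def \<phi>_def e_def)
      (metis enumerate_mono lessI less_irrefl)
  ultimately have "ignores n f X i"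
    using tuples[OF p] shift[OF p i(1) refl] by (intro ignores_if_one_change[OF inv i(1)]) simp_all
  then show False using i(2) by contradiction
qed

text \<open>
  Consider the last relevant coordinate \<open>d\<close> where \<open>p\<close> and \<open>q\<close> differ. The larger of the two entries
  there must occur as a relevant entry of the other tuple, at a place where the tuples differ as
  well. By the choice of \<open>d\<close> this place is at most \<open>d\<close>, so that entry is too small.
\<close>

lemma eq_imp_agree:
  assumes inv: "pattern_invariant n f X" and X: "infinite X"
    and p: "p \<in> increasing_tuples n X" and q: "q \<in> increasing_tuples n X" and eq: "f p = f q"
    and "i < n" "\<not> ignores n f X i"
  shows "p ! i = q ! i"
proof (rule ccontr)
  define D where "D = {j. j < n \<and> \<not> ignores n f X j \<and> p ! j \<noteq> q ! j}"
  assume "p ! i \<noteq> q ! i"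
  then have D: "finite D" "D \<noteq> {}" using assms by (auto simp: D_def)
  define d where "d = Max D"
  have d: "d < n" "\<not> ignores n f X d" "p ! d \<noteq> q ! d"
    using Max_in[OF D] by (auto simp: d_def D_def)
  have above: "r ! j \<le> r ! d" if "r \<in> increasing_tuples n X" "j \<in> D" for j r
    using Max_ge[OF D(1) that(2)] that(1) d(1)
    by (cases "j = d") (auto simp: increasing_tuples_iff_nth d_def intro!: less_imp_le)
  have no_match: False
    if r: "r \<in> increasing_tuples n X" and s: "s \<in> increasing_tuples n X" and "f r = f s"
      and less: "r ! d < s ! d" and rs: "\<And>j. r ! j \<noteq> s ! j \<longleftrightarrow> p ! j \<noteq> q ! j" for r s
  proof -
    obtain j where j: "j < n" "\<not> ignores n f X j" "r ! j = s ! d"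
      using eq_imp_matching_coordinate[OF inv X s r _ d(1,2)] \<open>f r = f s\<close> by auto
    have "s ! j \<noteq> r ! j"
    proof
      assume "s ! j = r ! j"
      then have "j = d" using s j d(1) by (metis increasing_tuples_iff_nth linorder_neqE_nat less_irrefl)
      then show False using j(3) less by simp
    qed
    then have "j \<in> D" using j rs[of j] by (auto simp: D_def)
    then show False using above[OF r] j(3) less by fastforce
  qed
  show False using no_match[OF p q eq] no_match[OF q p eq[symmetric]] d(3) by (metis linorder_neqE_nat)
qed

lemma pattern_invariant_imp_sel_upward_inj_wrt:
  assumes "pattern_invariant n f X" "infinite X"
  shows "sel_upward_inj_wrt n f X {i. i < n \<and> \<not> ignores n f X i}"
  unfolding sel_upward_inj_wrt_def
proof (intro ballI iffI)
  fix p q assume pq: "p \<in> increasing_tuples n X" "q \<in> increasing_tuples n X"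
  show "p ! i = q ! i" if "f p = f q" "i \<in> {i. i < n \<and> \<not> ignores n f X i}" for i
    using that(2) eq_imp_agree[OF assms pq that(1)] by simp
  show "f p = f q" if "\<forall>i\<in>{i. i < n \<and> \<not> ignores n f X i}. p ! i = q ! i"
    by (rule eq_if_agree[OF pq]) (use that in simp)
qed

section \<open>Partitions and functions\<close>

lemma enumerate_set_increasing:
  fixes xs :: "nat list"
  shows "sorted_wrt (<) xs \<Longrightarrow> i < length xs \<Longrightarrow> enumerate (set xs) i = xs ! i"
proof (induction xs arbitrary: i)
  case (Cons x xs)
  have least: "(LEAST y. y \<in> set (x # xs)) = x"
    using Cons.prems(1) by (intro Least_equality) (auto intro: less_imp_le)
  have "set (x # xs) - {x} = set xs" using Cons.prems(1) by auto
  then show ?case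
    using Cons least by (cases i) (simp_all add: enumerate_0 enumerate_Suc)
qed simp

lemma canonical_wrt_iff_sel_upward_inj_wrt:
  assumes I: "I \<subseteq> {..<n}"
    and f: "\<And>xs ys. xs \<in> increasing_tuples n UNIV \<Longrightarrow> ys \<in> increasing_tuples n UNIV \<Longrightarrow>
      part_equiv \<P> (set xs) (set ys) \<longleftrightarrow> f xs = f ys"
  shows "canonical_wrt n I \<P> X \<longleftrightarrow> sel_upward_inj_wrt n f X I"
proof -
  have nsets: "[X]\<^bsup>n\<^esup> = set ` increasing_tuples n X"
    using increasing_tuples_imp_nsets by (auto elim!: nsetsE_increasing_tuple)
  have tuples: "part_equiv \<P> (set xs) (set ys) \<longleftrightarrow> f xs = f ys"
    if "xs \<in> increasing_tuples n X" "ys \<in> increasing_tuples n X" for xs ys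
    using f increasing_tuples_mono[of X UNIV n] that by blast
  have nth: "enumerate (set xs) i = xs ! i" if "xs \<in> increasing_tuples n X" "i \<in> I" for xs i
    using that I by (intro enumerate_set_increasing) (auto simp: increasing_tuples_def)
  show ?thesis
    unfolding canonical_wrt_def sel_upward_inj_wrt_def nsets by (simp add: tuples nth cong: ball_cong)
qed

lemma sel_upward_inj_or_const_iff:
  "sel_upward_inj n f X \<or> upward_const n f X \<longleftrightarrow> (\<exists>I\<subseteq>{..<n}. sel_upward_inj_wrt n f X I)"
  unfolding sel_upward_inj_def upward_const_def by blast

text \<open>
  A class is coded by a list that enumerates one of its members. The list is chosen by a predicate
  that depends only on the class.
\<close>

lemma partition_as_function:
  assumes P: "weak_partition ([UNIV :: nat set]\<^bsup>n\<^esup>) \<P>"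
  obtains f :: "nat list \<Rightarrow> nat"
  where "\<And>xs ys. xs \<in> increasing_tuples n UNIV \<Longrightarrow> ys \<in> increasing_tuples n UNIV \<Longrightarrow>
      part_equiv \<P> (set xs) (set ys) \<longleftrightarrow> f xs = f ys"
proof
  define rep where "rep xs = (SOME zs :: nat list. part_equiv \<P> (set zs) (set xs))" for xs
  fix xs ys :: "nat list"
  assume "xs \<in> increasing_tuples n UNIV" "ys \<in> increasing_tuples n UNIV"
  then have "part_equiv \<P> (set xs) (set xs)" "part_equiv \<P> (set ys) (set ys)"
    using P increasing_tuples_imp_nsets by (auto simp: weak_partition_def part_equiv_def)
  then have rep: "part_equiv \<P> (set (rep xs)) (set xs)" "part_equiv \<P> (set (rep ys)) (set ys)"
    unfolding rep_def
    using someI[of "\<lambda>zs. part_equiv \<P> (set zs) (set xs)" xs]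
      someI[of "\<lambda>zs. part_equiv \<P> (set zs) (set ys)" ys] by blast+
  have sym: "part_equiv \<P> p q \<Longrightarrow> part_equiv \<P> q p" for p q by (auto simp: part_equiv_def)
  have trans: "part_equiv \<P> p q \<Longrightarrow> part_equiv \<P> q r \<Longrightarrow> part_equiv \<P> p r" for p q r
    using P unfolding weak_partition_def part_equiv_def disjoint_def by blast
  have "part_equiv \<P> (set xs) (set ys) \<longleftrightarrow> rep xs = rep ys"
  proof
    assume "part_equiv \<P> (set xs) (set ys)"
    then have "part_equiv \<P> p (set xs) \<longleftrightarrow> part_equiv \<P> p (set ys)" for p
      using sym trans by blast
    then show "rep xs = rep ys" by (simp add: rep_def)
  next
    assume "rep xs = rep ys"
    then show "part_equiv \<P> (set xs) (set ys)" using rep sym trans by metis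
  qed
  then show "part_equiv \<P> (set xs) (set ys) \<longleftrightarrow> list_encode (rep xs) = list_encode (rep ys)"
    by (simp add: list_encode_eq)
qed

text \<open>
  Empty classes occur for the values that \<open>f\<close> omits; a weak partition may contain the empty set.
\<close>

lemma function_as_partition:
  fixes f :: "nat list \<Rightarrow> nat"
  obtains \<P> where "weak_partition ([UNIV :: nat set]\<^bsup>n\<^esup>) \<P>"
    "\<And>xs ys. xs \<in> increasing_tuples n UNIV \<Longrightarrow> ys \<in> increasing_tuples n UNIV \<Longrightarrow>
      part_equiv \<P> (set xs) (set ys) \<longleftrightarrow> f xs = f ys"
proof
  define C where "C c = {p \<in> [UNIV :: nat set]\<^bsup>n\<^esup>. f (sorted_list_of_set p) = c}" for c
  show "weak_partition ([UNIV :: nat set]\<^bsup>n\<^esup>) (range C)"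
    by (auto simp: weak_partition_def disjoint_def C_def)
  fix xs ys :: "nat list"
  assume xs: "xs \<in> increasing_tuples n UNIV" and ys: "ys \<in> increasing_tuples n UNIV"
  have "sorted_list_of_set (set zs) = zs" if "zs \<in> increasing_tuples n UNIV" for zs
    using that by (intro strict_sorted_equal) (auto simp: increasing_tuples_def)
  then show "part_equiv (range C) (set xs) (set ys) \<longleftrightarrow> f xs = f ys"
    using increasing_tuples_imp_nsets[OF xs] increasing_tuples_imp_nsets[OF ys] xs ys
    by (auto simp: part_equiv_def C_def)
qed

section \<open>Equivalence of the four conditions\<close>

lemma upward_generated_imp_sel_upward_inj:
  fixes f :: "nat list \<Rightarrow> nat"
  assumes u: "ultrafilter u" and np: "\<not> is_principal u" and gen: "upward_generated u"
  shows "\<exists>X\<in>u. sel_upward_inj n f X \<or> upward_const n f X"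
proof -
  obtain X where X: "X \<in> u" "pattern_invariant n f X"
    by (rule upward_generated_imp_pattern_invariant[OF u gen])
  have "sel_upward_inj_wrt n f X {i. i < n \<and> \<not> ignores n f X i}"
    by (rule pattern_invariant_imp_sel_upward_inj_wrt[OF X(2) nonprincipal_infinite[OF u np X(1)]])
  moreover have "{i. i < n \<and> \<not> ignores n f X i} \<subseteq> {..<n}" by auto
  ultimately show ?thesis unfolding sel_upward_inj_or_const_iff using X(1) by blast
qed

lemma canonical_iff_sel_upward_inj:
  "(\<forall>\<P>. weak_partition ([UNIV :: nat set]\<^bsup>n\<^esup>) \<P> \<longrightarrow> (\<exists>X\<in>u. canonical n \<P> X)) \<longleftrightarrow>
   (\<forall>f :: nat list \<Rightarrow> nat. \<exists>X\<in>u. sel_upward_inj n f X \<or> upward_const n f X)"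
  (is "?canonical \<longleftrightarrow> ?functions")
proof
  assume can: ?canonical
  show ?functions
  proof
    fix f :: "nat list \<Rightarrow> nat"
    obtain \<P> where P: "weak_partition ([UNIV :: nat set]\<^bsup>n\<^esup>) \<P>"
      "\<And>xs ys. xs \<in> increasing_tuples n UNIV \<Longrightarrow> ys \<in> increasing_tuples n UNIV \<Longrightarrow>
        part_equiv \<P> (set xs) (set ys) \<longleftrightarrow> f xs = f ys"
      by (rule function_as_partition[of n f]) (rule that)
    obtain X I where "X \<in> u" "I \<subseteq> {..<n}" "canonical_wrt n I \<P> X"
      using can P(1) unfolding canonical_def by blast
    then show "\<exists>X\<in>u. sel_upward_inj n f X \<or> upward_const n f X"
      using canonical_wrt_iff_sel_upward_inj_wrt[where f = f, OF _ P(2)]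
      unfolding sel_upward_inj_or_const_iff by blast
  qed
next
  assume funs: ?functions
  show ?canonical
  proof (intro allI impI)
    fix \<P> assume P: "weak_partition ([UNIV :: nat set]\<^bsup>n\<^esup>) \<P>"
    obtain f :: "nat list \<Rightarrow> nat" where f:
      "\<And>xs ys. xs \<in> increasing_tuples n UNIV \<Longrightarrow> ys \<in> increasing_tuples n UNIV \<Longrightarrow>
        part_equiv \<P> (set xs) (set ys) \<longleftrightarrow> f xs = f ys"
      by (rule partition_as_function[OF P]) (rule that)
    obtain X I where "X \<in> u" "I \<subseteq> {..<n}" "sel_upward_inj_wrt n f X I"
      using funs unfolding sel_upward_inj_or_const_iff by blast
    then show "\<exists>X\<in>u. canonical n \<P> X"
      using canonical_wrt_iff_sel_upward_inj_wrt[where f = f, OF _ f]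
      unfolding canonical_def by blast
  qed
qed

lemma sel_upward_inj_imp_product:
  assumes u: "ultrafilter u" and np: "\<not> is_principal u" and X: "X \<in> u"
    and f: "sel_upward_inj n f X"
  shows "\<exists>m. 1 \<le> m \<and> m \<le> n \<and> uf_ext f (replicate n u) \<approx>\<^sub>R\<^sub>K uf_prod (replicate m u)"
proof -
  obtain J where J: "J \<subseteq> {..<n}" "J \<noteq> {}" "sel_upward_inj_wrt n f X J"
    using f unfolding sel_upward_inj_def by blast
  have "finite J" using J(1) finite_subset by blast
  then have "1 \<le> card J" using J(2) by (simp add: Suc_le_eq card_gt_0_iff)
  moreover have "card J \<le> n" using card_mono[OF _ J(1)] by simp
  ultimately show ?thesis
    using sel_upward_inj_wrt_imp_product[OF u np X J(1,3)] by blast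
qed

theorem theorem3:
  fixes u :: "nat set set"
  assumes "ultrafilter u" and "\<not> is_principal u"
  shows "(ramsey_ultrafilter u \<longleftrightarrow>
            (\<forall>n\<ge>1. \<forall>\<P>. weak_partition ([UNIV :: nat set]\<^bsup>n\<^esup>) \<P> \<longrightarrow> (\<exists>X\<in>u. canonical n \<P> X)))
       \<and> (ramsey_ultrafilter u \<longleftrightarrow>
            (\<forall>n\<ge>1. \<forall>f :: nat list \<Rightarrow> nat. \<exists>X\<in>u. sel_upward_inj n f X \<or> upward_const n f X))
       \<and> (ramsey_ultrafilter u \<longleftrightarrow>
            (\<forall>n\<ge>1. \<forall>f :: nat list \<Rightarrow> nat.
               is_principal (uf_ext f (replicate n u)) \<or>
               (\<exists>m. 1 \<le> m \<and> m \<le> n \<and> uf_ext f (replicate n u) \<approx>\<^sub>R\<^sub>K uf_prod (replicate m u))))"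
    (is "(_ \<longleftrightarrow> ?canonical) \<and> (_ \<longleftrightarrow> ?functions) \<and> (_ \<longleftrightarrow> ?images)")
proof -
  note u = assms(1) and np = assms(2)
  have canonical: "?canonical \<longleftrightarrow> ?functions" by (simp only: canonical_iff_sel_upward_inj)
  have upward: ?functions if "ramsey_ultrafilter u"
    using upward_generated_imp_sel_upward_inj[OF u np]
      ramsey_ultrafilter_imp_upward_generated[OF that] by blast
  have images: ?images if funs: ?functions
  proof (intro allI impI)
    fix n :: nat and f :: "nat list \<Rightarrow> nat"
    assume "1 \<le> n"
    then obtain X where X: "X \<in> u" "sel_upward_inj n f X \<or> upward_const n f X"
      using funs by blast
    from X(2) show "is_principal (uf_ext f (replicate n u)) \<or>
        (\<exists>m. 1 \<le> m \<and> m \<le> n \<and> uf_ext f (replicate n u) \<approx>\<^sub>R\<^sub>K uf_prod (replicate m u))"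
    proof
      assume "sel_upward_inj n f X"
      then show ?thesis using sel_upward_inj_imp_product[OF u np X(1)] by blast
    next
      assume "upward_const n f X"
      then show ?thesis using upward_const_imp_principal[OF u np X(1)] by blast
    qed
  qed
  have ramsey: "ramsey_ultrafilter u" if images: ?images
  proof -
    have "is_principal (uf_ext f [u]) \<or> uf_ext f [u] \<approx>\<^sub>R\<^sub>K uf_prod [u]" for f :: "nat list \<Rightarrow> nat"
    proof -
      have "is_principal (uf_ext f (replicate 1 u)) \<or>
          (\<exists>m. 1 \<le> m \<and> m \<le> 1 \<and> uf_ext f (replicate 1 u) \<approx>\<^sub>R\<^sub>K uf_prod (replicate m u))"
        using images by blast
      moreover have "m = 1" if "1 \<le> m" "m \<le> 1" for m :: nat using that by simp
      ultimately show ?thesis by (auto simp del: uf_ext.simps)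
    qed
    then have "selective u" by (rule RK_minimal_imp_selective[OF u])
    then show ?thesis
      using upward_generated_imp_ramsey_ultrafilter[OF u np] selective_imp_upward_generated[OF u np]
      by blast
  qed
  show ?thesis using canonical upward images ramsey by argo
qed

end
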